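(* Let $F_n$ be the free group of rank $n$, $\varphi\in\mathrm{Aut}(F_n)$, $G=F_n\rtimes_\varphi\mathbb{Z}$, and let $[\overline{\varphi}]\in\mathrm{GL}_n(\mathbb{Z})$ be the matrix of the automorphism $\overline{\varphi}$ of $F_n^{ab}$ induced by $\varphi$. If all eigenvalues of $[\overline{\varphi}]$ are integers, then $G$ is residually nilpotent. Moreover, in this case: (a) if all the eigenvalues are equal to $1$, then $G$ is residually $p$-finite for every prime $p$; (b) if at least one eigenvalue is equal to $-1$, then $G$ is residually $2$-finite.
   Context: $F_n^{ab}=F_n/[F_n,F_n]\cong\mathbb{Z}^n$. $F_n\rtimes_\varphi\mathbb{Z}=\langle x_1,\dots,x_n,t\mid t^{-1}x_it=\varphi(x_i),\ i=1,\dots,n\rangle$. A group is residually nilpotent (respectively residually $p$-finite) if every non-identity element has non-trivial image under some homomorphism to a nilpotent group (respectively to a finite $p$-group). *)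

theory Defs
  imports
    "HOL-Algebra.Bij"
    "HOL-Algebra.Elementary_Groups"
    "HOL-Algebra.Generated_Groups"
    "HOL-Computational_Algebra.Primes"
    "Jordan_Normal_Form.Char_Poly"
begin

section \<open>The free group of rank n\<close>

text \<open>The letter \<open>(i, True)\<close> is the generator \<open>x\<^sub>i\<close> and \<open>(i, False)\<close> its inverse; generators
  are numbered from 0. The elements of the free group are the reduced words, and the product is
  concatenation followed by free cancellation.\<close>

type_synonym letter = "nat \<times> bool"

definition inv_letter :: "letter \<Rightarrow> letter" where
  "inv_letter a = (fst a, \<not> snd a)"

definition reduced :: "letter list \<Rightarrow> bool" where
  "reduced w \<longleftrightarrow> successively (\<lambda>a b. b \<noteq> inv_letter a) w"

fun push :: "letter \<Rightarrow> letter list \<Rightarrow> letter list" where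
  "push a [] = [a]"
| "push a (b # w) = (if b = inv_letter a then w else a # b # w)"

definition free_group :: "nat \<Rightarrow> letter list monoid" where
  "free_group n =
     \<lparr>carrier = {w. fst ` set w \<subseteq> {..<n} \<and> reduced w},
      monoid.mult = (\<lambda>u v. foldr push u v),
      one = []\<rparr>"

definition free_gen :: "nat \<Rightarrow> letter list" where
  "free_gen i = [(i, True)]"


section \<open>Semidirect products\<close>

definition semidirect_product ::
    "('a, 'c) monoid_scheme \<Rightarrow> ('b, 'd) monoid_scheme \<Rightarrow> ('b \<Rightarrow> 'a \<Rightarrow> 'a) \<Rightarrow> ('a \<times> 'b) monoid" where
  "semidirect_product N H \<theta> =
     \<lparr>carrier = carrier N \<times> carrier H,
      monoid.mult = (\<lambda>(a, h) (b, k). (a \<otimes>\<^bsub>N\<^esub> \<theta> h b, h \<otimes>\<^bsub>H\<^esub> k)),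
      one = (\<one>\<^bsub>N\<^esub>, \<one>\<^bsub>H\<^esub>)\<rparr>"

text \<open>In \<open>semidirect_int N \<phi>\<close> the pair \<open>(a, i)\<close> stands for \<open>a t\<^sup>i\<close>. The integer \<open>i\<close> acts through
  \<open>\<phi>\<close> to the power \<open>-i\<close>, so that \<open>t\<^sup>-\<^sup>1 a t = \<phi> a\<close> (and not \<open>t a t\<^sup>-\<^sup>1 = \<phi> a\<close>).\<close>

definition semidirect_int ::
    "('a, 'c) monoid_scheme \<Rightarrow> ('a \<Rightarrow> 'a) \<Rightarrow> ('a \<times> int) monoid" where
  "semidirect_int N \<phi> =
     semidirect_product N integer_group (\<lambda>i::int. \<phi> [^]\<^bsub>AutoGroup N\<^esub> (- i))"


section \<open>The matrix of the automorphism induced on the abelianization\<close>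

definition abelianization :: "('a, 'b) monoid_scheme \<Rightarrow> 'a set monoid" where
  "abelianization G = G Mod derived G (carrier G)"

definition ab_class :: "('a, 'b) monoid_scheme \<Rightarrow> 'a \<Rightarrow> 'a set" where
  "ab_class G g = derived G (carrier G) #>\<^bsub>G\<^esub> g"

text \<open>An element of the abelianization is a coset of \<open>[G, G]\<close>, and the map induced by an
  automorphism sends this coset to its image, see \<open>ab_map_ab_class\<close> below.\<close>

definition ab_map :: "('a \<Rightarrow> 'a) \<Rightarrow> 'a set \<Rightarrow> 'a set" where
  "ab_map \<phi> C = \<phi> ` C"

text \<open>The classes of the generators form the basis of the abelianization of the free group; column
  \<open>j\<close> of the matrix contains the coordinates of the image of the \<open>j\<close>-th basis element. Existence
  and uniqueness of the matrix are proved below (\<open>ex1_ab_matrix\<close>).\<close>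

definition is_ab_matrix :: "nat \<Rightarrow> (letter list \<Rightarrow> letter list) \<Rightarrow> int mat \<Rightarrow> bool" where
  "is_ab_matrix n \<phi> A \<longleftrightarrow>
     A \<in> carrier_mat n n \<and>
     (\<forall>j<n. ab_map \<phi> (ab_class (free_group n) (free_gen j)) =
        finprod (abelianization (free_group n))
          (\<lambda>i. ab_class (free_group n) (free_gen i)
                 [^]\<^bsub>abelianization (free_group n)\<^esub> (A $$ (i, j))) {..<n})"

definition ab_matrix :: "nat \<Rightarrow> (letter list \<Rightarrow> letter list) \<Rightarrow> int mat" where
  "ab_matrix n \<phi> = (THE A. is_ab_matrix n \<phi> A)"


section \<open>Residual properties\<close>

text \<open>\<open>lower_central G k\<close> is the term with index \<open>k + 1\<close> in the usual numbering.\<close>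

primrec lower_central :: "('a, 'b) monoid_scheme \<Rightarrow> nat \<Rightarrow> 'a set" where
  "lower_central G 0 = carrier G"
| "lower_central G (Suc k) =
     generate G (\<Union>h \<in> lower_central G k. \<Union>g \<in> carrier G.
       {h \<otimes>\<^bsub>G\<^esub> g \<otimes>\<^bsub>G\<^esub> inv\<^bsub>G\<^esub> h \<otimes>\<^bsub>G\<^esub> inv\<^bsub>G\<^esub> g})"

definition nilpotent_group :: "('a, 'b) monoid_scheme \<Rightarrow> bool" where
  "nilpotent_group G \<longleftrightarrow> group G \<and> (\<exists>k. lower_central G k = {\<one>\<^bsub>G\<^esub>})"

definition finite_p_group :: "nat \<Rightarrow> ('a, 'b) monoid_scheme \<Rightarrow> bool" where
  "finite_p_group p G \<longleftrightarrow> group G \<and> finite (carrier G) \<and> (\<exists>k. Coset.order G = p ^ k)"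

text \<open>HOL cannot quantify over target groups of arbitrary type. Since the target may be
  replaced by the quotient of \<open>G\<close> by the kernel, targets of type \<open>'a set monoid\<close> suffice; see
  \<open>nilpotent_target_any_type\<close> and \<open>finite_p_target_any_type\<close> below.\<close>

definition residually_nilpotent :: "('a, 'b) monoid_scheme \<Rightarrow> bool" where
  "residually_nilpotent G \<longleftrightarrow>
     (\<forall>g \<in> carrier G. g \<noteq> \<one>\<^bsub>G\<^esub> \<longrightarrow>
        (\<exists>(K :: 'a set monoid) h. nilpotent_group K \<and> h \<in> hom G K \<and> h g \<noteq> \<one>\<^bsub>K\<^esub>))"

definition residually_p_finite :: "nat \<Rightarrow> ('a, 'b) monoid_scheme \<Rightarrow> bool" where
  "residually_p_finite p G \<longleftrightarrow>
     (\<forall>g \<in> carrier G. g \<noteq> \<one>\<^bsub>G\<^esub> \<longrightarrow>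
        (\<exists>(K :: 'a set monoid) h. finite_p_group p K \<and> h \<in> hom G K \<and> h g \<noteq> \<one>\<^bsub>K\<^esub>))"


section \<open>The free group: group laws and universal property\<close>

lemma inv_letter_inv_letter [simp]: "inv_letter (inv_letter a) = a"
  by (simp add: inv_letter_def)

lemma fst_inv_letter [simp]: "fst (inv_letter a) = fst a"
  by (simp add: inv_letter_def)

lemma inv_letter_neq [simp]: "inv_letter a \<noteq> a" "a \<noteq> inv_letter a"
  by (simp_all add: inv_letter_def prod_eq_iff)

lemma reduced_Nil [simp]: "reduced []"
  by (simp add: reduced_def)

lemma reduced_single [simp]: "reduced [a]"
  by (simp add: reduced_def)

lemma reduced_Cons2 [simp]:
  "reduced (a # b # w) \<longleftrightarrow> b \<noteq> inv_letter a \<and> reduced (b # w)"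
  by (simp add: reduced_def)

lemma reduced_tl: "reduced (a # w) \<Longrightarrow> reduced w"
  by (cases w) auto

lemma reduced_push: "reduced w \<Longrightarrow> reduced (push a w)"
  by (cases w) (auto dest: reduced_tl)

lemma reduced_foldr_push: "reduced w \<Longrightarrow> reduced (foldr push u w)"
  by (induction u) (auto intro: reduced_push)

lemma set_push: "set (push a w) \<subseteq> insert a (set w)"
  by (cases w) auto

lemma set_foldr_push: "set (foldr push u w) \<subseteq> set u \<union> set w"
proof (induction u)
  case (Cons a u)
  then show ?case using set_push[of a "foldr push u w"] by auto
qed auto

lemma push_reduced: "reduced (a # w) \<Longrightarrow> push a w = a # w"
  by (cases w) auto

lemma push_inv_push: "reduced w \<Longrightarrow> push a (push (inv_letter a) w) = w"
  by (cases w) (auto simp: push_reduced)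

lemma foldr_push_push:
  assumes "reduced w"
  shows "foldr push (push a v) w = push a (foldr push v w)"
proof (cases v)
  case (Cons b v')
  then show ?thesis
    using push_inv_push[OF reduced_foldr_push[OF assms], of a v'] by auto
qed auto

lemma foldr_push_assoc:
  "reduced w \<Longrightarrow> foldr push (foldr push u v) w = foldr push u (foldr push v w)"
  by (induction u) (auto simp: foldr_push_push)

lemma foldr_push_Nil: "reduced w \<Longrightarrow> foldr push w [] = w"
proof (induction w)
  case (Cons a w)
  then show ?case using reduced_tl[OF Cons.prems] push_reduced[OF Cons.prems] by simp
qed simp

definition inv_word :: "letter list \<Rightarrow> letter list" where
  "inv_word w = rev (map inv_letter w)"

lemma reduced_inv_word: "reduced w \<Longrightarrow> reduced (inv_word w)"
  unfolding reduced_def inv_word_def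
  by (auto simp: successively_map elim!: successively_mono)

lemma foldr_push_inv_word:
  "reduced v \<Longrightarrow> foldr push (inv_word w) (foldr push w v) = v"
proof (induction w arbitrary: v)
  case (Cons a w)
  have "push (inv_letter a) (push a (foldr push w v)) = foldr push w v"
    using push_inv_push[OF reduced_foldr_push[OF Cons.prems], of "inv_letter a" w] by simp
  with Cons show ?case by (simp add: inv_word_def)
qed (simp add: inv_word_def)

lemma carrier_free_group:
  "w \<in> carrier (free_group n) \<longleftrightarrow> fst ` set w \<subseteq> {..<n} \<and> reduced w"
  by (simp add: free_group_def)

lemma mult_free_group: "u \<otimes>\<^bsub>free_group n\<^esub> v = foldr push u v"
  by (simp add: free_group_def)

lemma one_free_group: "\<one>\<^bsub>free_group n\<^esub> = []"
  by (simp add: free_group_def)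

lemma group_free_group: "group (free_group n)"
proof (rule groupI)
  fix u v assume "u \<in> carrier (free_group n)" "v \<in> carrier (free_group n)"
  then show "u \<otimes>\<^bsub>free_group n\<^esub> v \<in> carrier (free_group n)"
    using set_foldr_push[of u v]
    by (fastforce simp: carrier_free_group mult_free_group intro: reduced_foldr_push)
next
  fix u assume u: "u \<in> carrier (free_group n)"
  show "\<exists>v\<in>carrier (free_group n). v \<otimes>\<^bsub>free_group n\<^esub> u = \<one>\<^bsub>free_group n\<^esub>"
  proof
    show "inv_word u \<in> carrier (free_group n)"
      using u by (auto simp: carrier_free_group reduced_inv_word inv_word_def[of u])
        (auto simp: reduced_inv_word[unfolded inv_word_def])
    show "inv_word u \<otimes>\<^bsub>free_group n\<^esub> u = \<one>\<^bsub>free_group n\<^esub>"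
      using u foldr_push_inv_word[of "[]" u]
      by (simp add: carrier_free_group mult_free_group one_free_group foldr_push_Nil)
  qed
qed (auto simp: carrier_free_group mult_free_group one_free_group foldr_push_assoc)

lemma free_gen_closed: "i < n \<Longrightarrow> free_gen i \<in> carrier (free_group n)"
  by (simp add: free_gen_def carrier_free_group)

lemma inv_free_gen: "i < n \<Longrightarrow> inv\<^bsub>free_group n\<^esub> (free_gen i) = [(i, False)]"
  by (rule group.inv_equality[OF group_free_group])
     (auto simp: free_gen_def carrier_free_group mult_free_group one_free_group inv_letter_def)

lemma Cons_free_group:
  assumes "a # w \<in> carrier (free_group n)"
  shows "[a] \<in> carrier (free_group n)" "w \<in> carrier (free_group n)"
    "a # w = [a] \<otimes>\<^bsub>free_group n\<^esub> w"
  using assms by (auto simp: carrier_free_group mult_free_group push_reduced dest: reduced_tl)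

lemma letter_free_group:
  "i < n \<Longrightarrow> [(i, b)] = (if b then free_gen i else inv\<^bsub>free_group n\<^esub> (free_gen i))"
  by (simp add: inv_free_gen) (simp add: free_gen_def)

lemma generate_free_group:
  "generate (free_group n) (free_gen ` {..<n}) = carrier (free_group n)" (is "?L = _")
proof
  interpret F: group "free_group n" by (rule group_free_group)
  show "?L \<subseteq> carrier (free_group n)"
    by (rule F.generate_incl) (auto intro: free_gen_closed)
  show "carrier (free_group n) \<subseteq> ?L"
  proof
    fix w assume "w \<in> carrier (free_group n)"
    then show "w \<in> ?L"
    proof (induction w)
      case Nil
      then show ?case using generate.one[of "free_group n"] by (simp add: one_free_group)
    next
      case (Cons a w)
      obtain i b where a: "a = (i, b)" by (cases a)
      have i: "i < n" using Cons.prems a by (auto simp: carrier_free_group)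
      have "[a] \<in> ?L"
        unfolding a letter_free_group[OF i]
        using i by (auto intro: generate.incl generate.inv)
      then show ?case
        using Cons Cons_free_group[OF Cons.prems] generate.eng by metis
    qed
  qed
qed

lemma hom_eq_on_generate:
  assumes G: "group G" and K: "group K" and f: "f \<in> hom G K" and g: "g \<in> hom G K"
    and S: "S \<subseteq> carrier G" and eq: "\<And>x. x \<in> S \<Longrightarrow> f x = g x"
    and w: "w \<in> generate G S"
  shows "f w = g w"
proof -
  interpret f: group_hom G K f using G K f by (simp add: group_hom_def group_hom_axioms_def)
  interpret g: group_hom G K g using G K g by (simp add: group_hom_def group_hom_axioms_def)
  show ?thesis using w
  proof (induction rule: generate.induct)
    case (inv h)
    then show ?case using S eq by (metis f.hom_inv g.hom_inv subsetD)
  next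
    case (eng h1 h2)
    then show ?case using f.G.generate_in_carrier[OF S] by simp
  qed (auto simp: eq)
qed

lemma free_group_hom_eq:
  assumes "group K" "f \<in> hom (free_group n) K" "g \<in> hom (free_group n) K"
    and "\<And>i. i < n \<Longrightarrow> f (free_gen i) = g (free_gen i)" and "w \<in> carrier (free_group n)"
  shows "f w = g w"
  using hom_eq_on_generate[OF group_free_group assms(1-3), of "free_gen ` {..<n}" w] assms(4,5)
  by (auto simp: generate_free_group intro: free_gen_closed)

definition letter_val :: "('b, 'c) monoid_scheme \<Rightarrow> (nat \<Rightarrow> 'b) \<Rightarrow> letter \<Rightarrow> 'b" where
  "letter_val K y a = (if snd a then y (fst a) else inv\<^bsub>K\<^esub> (y (fst a)))"

definition word_val :: "('b, 'c) monoid_scheme \<Rightarrow> (nat \<Rightarrow> 'b) \<Rightarrow> letter list \<Rightarrow> 'b" where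
  "word_val K y w = foldr (\<lambda>a z. letter_val K y a \<otimes>\<^bsub>K\<^esub> z) w \<one>\<^bsub>K\<^esub>"

lemma word_val_hom:
  assumes "group K" and y: "\<And>i. i < n \<Longrightarrow> y i \<in> carrier K"
  shows "word_val K y \<in> hom (free_group n) K"
proof -
  interpret K: group K by fact
  have l: "letter_val K y a \<in> carrier K" if "fst a < n" for a
    using that y by (auto simp: letter_val_def)
  have il: "letter_val K y a \<otimes>\<^bsub>K\<^esub> (letter_val K y (inv_letter a) \<otimes>\<^bsub>K\<^esub> z) = z"
    if "fst a < n" "z \<in> carrier K" for a z
    using that y by (auto simp: letter_val_def inv_letter_def K.m_assoc[symmetric])
  have c: "word_val K y w \<in> carrier K" if "fst ` set w \<subseteq> {..<n}" for w
    using that by (induction w) (auto simp: word_val_def l)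
  have p: "word_val K y (push a w) = letter_val K y a \<otimes>\<^bsub>K\<^esub> word_val K y w"
    if "fst a < n" "fst ` set w \<subseteq> {..<n}" for a w
  proof (cases w)
    case (Cons b w')
    then show ?thesis
      using that il[of a "word_val K y w'"] c[of w'] by (auto simp: word_val_def)
  qed (simp add: word_val_def)
  have m: "word_val K y (foldr push u v) = word_val K y u \<otimes>\<^bsub>K\<^esub> word_val K y v"
    if "fst ` set u \<subseteq> {..<n}" "fst ` set v \<subseteq> {..<n}" for u v
    using that(1)
  proof (induction u)
    case Nil
    then show ?case using c[OF that(2)] by (simp add: word_val_def)
  next
    case (Cons a u)
    have uv: "fst ` set (foldr push u v) \<subseteq> {..<n}"
      using Cons.prems that(2) set_foldr_push[of u v] by fastforce
    have "word_val K y (a # u) = letter_val K y a \<otimes>\<^bsub>K\<^esub> word_val K y u"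
      by (simp add: word_val_def)
    then show ?case
      using Cons p[OF _ uv, of a] c[OF that(2)] c[of u] l[of a] by (simp add: K.m_assoc)
  qed
  show ?thesis
    by (rule homI) (auto simp: carrier_free_group mult_free_group intro!: c m)
qed

lemma word_val_free_gen:
  "group K \<Longrightarrow> y i \<in> carrier K \<Longrightarrow> word_val K y (free_gen i) = y i"
  by (simp add: word_val_def letter_val_def free_gen_def group.is_monoid)


section \<open>The semidirect product: group laws and presentation\<close>

lemma AutoGroup_simps:
  "carrier (AutoGroup N) = auto N"
  "\<one>\<^bsub>AutoGroup N\<^esub> = (\<lambda>x\<in>carrier N. x)"
  "f \<in> auto N \<Longrightarrow> g \<in> auto N \<Longrightarrow> f \<otimes>\<^bsub>AutoGroup N\<^esub> g = compose (carrier N) f g"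
  by (auto simp: AutoGroup_def BijGroup_def auto_def)

lemma auto_closed: "f \<in> auto N \<Longrightarrow> x \<in> carrier N \<Longrightarrow> f x \<in> carrier N"
  by (auto simp: auto_def hom_def)

lemma auto_mult:
  "f \<in> auto N \<Longrightarrow> x \<in> carrier N \<Longrightarrow> y \<in> carrier N \<Longrightarrow> f (x \<otimes>\<^bsub>N\<^esub> y) = f x \<otimes>\<^bsub>N\<^esub> f y"
  by (auto simp: auto_def hom_def)

lemma group_semidirect_product:
  assumes N: "group N" and H: "group H" and \<theta>: "\<theta> \<in> hom H (AutoGroup N)"
  shows "group (semidirect_product N H \<theta>)"
proof -
  interpret N: group N by fact
  interpret H: group H by fact
  interpret A: group "AutoGroup N" by (rule N.AutoGroup)
  interpret T: group_hom H "AutoGroup N" \<theta>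
    using \<theta> by (simp add: group_hom_def group_hom_axioms_def H A.is_group)
  have aut: "\<theta> h \<in> auto N" if "h \<in> carrier H" for h
    using that T.hom_closed by (simp add: AutoGroup_simps)
  have comp: "\<theta> (h \<otimes>\<^bsub>H\<^esub> k) x = \<theta> h (\<theta> k x)"
    if "h \<in> carrier H" "k \<in> carrier H" "x \<in> carrier N" for h k x
    using that by (simp add: AutoGroup_simps aut compose_def)
  have one: "\<theta> \<one>\<^bsub>H\<^esub> x = x" if "x \<in> carrier N" for x
    using that T.hom_one by (simp add: AutoGroup_simps)
  note cl = auto_closed[OF aut]
  show ?thesis
  proof (rule groupI)
    fix x assume "x \<in> carrier (semidirect_product N H \<theta>)"
    then obtain a h where x: "x = (a, h)" "a \<in> carrier N" "h \<in> carrier H"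
      by (auto simp: semidirect_product_def)
    let ?y = "(\<theta> (inv\<^bsub>H\<^esub> h) (inv\<^bsub>N\<^esub> a), inv\<^bsub>H\<^esub> h)"
    have "\<theta> (inv\<^bsub>H\<^esub> h) (inv\<^bsub>N\<^esub> a) \<otimes>\<^bsub>N\<^esub> \<theta> (inv\<^bsub>H\<^esub> h) a = \<one>\<^bsub>N\<^esub>"
    proof -
      have *: "\<theta> (inv\<^bsub>H\<^esub> h) \<in> auto N" using x by (intro aut) simp
      then have "\<theta> (inv\<^bsub>H\<^esub> h) \<one>\<^bsub>N\<^esub> = \<one>\<^bsub>N\<^esub>" using N hom_one by (auto simp: auto_def)
      then show ?thesis
        using auto_mult[OF *, of "inv\<^bsub>N\<^esub> a" a] x by (simp only: N.l_inv N.inv_closed)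
    qed
    then     show "\<exists>y\<in>carrier (semidirect_product N H \<theta>).
        y \<otimes>\<^bsub>semidirect_product N H \<theta>\<^esub> x = \<one>\<^bsub>semidirect_product N H \<theta>\<^esub>"
      using x cl by (intro bexI[of _ ?y]) (auto simp: semidirect_product_def simp del: T.hom_inv)
  qed (auto simp: semidirect_product_def cl comp one auto_mult[OF aut] N.m_assoc H.m_assoc
      simp del: T.hom_mult T.hom_one)
qed

lemma int_pow_auto_hom:
  assumes "group N" "\<phi> \<in> auto N"
  shows "(\<lambda>i::int. \<phi> [^]\<^bsub>AutoGroup N\<^esub> (- i)) \<in> hom integer_group (AutoGroup N)"
proof -
  interpret N: group N by fact
  interpret A: group "AutoGroup N" by (rule N.AutoGroup)
  have \<phi>: "\<phi> \<in> carrier (AutoGroup N)" using assms by (simp add: AutoGroup_simps)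
  show ?thesis
    by (rule homI) (auto simp: \<phi> A.int_pow_mult[symmetric] add.commute)
qed

lemma group_semidirect_int:
  "group N \<Longrightarrow> \<phi> \<in> auto N \<Longrightarrow> group (semidirect_int N \<phi>)"
  unfolding semidirect_int_def
  by (intro group_semidirect_product group_integer_group int_pow_auto_hom)

context
  fixes N (structure) and \<phi>
  assumes N: "group N" and \<phi>: "\<phi> \<in> auto N"
begin

interpretation N: group N by (rule N)
interpretation A: group "AutoGroup N" by (rule N.AutoGroup)
interpretation S: group "semidirect_int N \<phi>" by (rule group_semidirect_int[OF N \<phi>])

private lemma \<phi>': "\<phi> \<in> carrier (AutoGroup N)"
  using \<phi> by (simp add: AutoGroup_simps)

lemma int_pow_auto_closed: "\<phi> [^]\<^bsub>AutoGroup N\<^esub> (i::int) \<in> auto N"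
  using A.int_pow_closed[OF \<phi>'] by (simp add: AutoGroup_simps)

lemma int_pow_auto_add:
  "x \<in> carrier N \<Longrightarrow>
     (\<phi> [^]\<^bsub>AutoGroup N\<^esub> (i + j::int)) x = (\<phi> [^]\<^bsub>AutoGroup N\<^esub> i) ((\<phi> [^]\<^bsub>AutoGroup N\<^esub> j) x)"
  by (simp add: A.int_pow_mult[OF \<phi>'] AutoGroup_simps int_pow_auto_closed compose_def)

lemma int_pow_auto_0: "x \<in> carrier N \<Longrightarrow> (\<phi> [^]\<^bsub>AutoGroup N\<^esub> (0::int)) x = x"
  by (simp add: AutoGroup_simps)

lemma int_pow_auto_1: "\<phi> [^]\<^bsub>AutoGroup N\<^esub> (1::int) = \<phi>"
  using A.int_pow_1[OF \<phi>'] .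

lemma carrier_semidirect_int: "carrier (semidirect_int N \<phi>) = carrier N \<times> UNIV"
  by (simp add: semidirect_int_def semidirect_product_def)

lemma mult_semidirect_int:
  "(a, i) \<otimes>\<^bsub>semidirect_int N \<phi>\<^esub> (b, j) = (a \<otimes> (\<phi> [^]\<^bsub>AutoGroup N\<^esub> (- i)) b, i + j)"
  by (simp add: semidirect_int_def semidirect_product_def)

lemma one_semidirect_int: "\<one>\<^bsub>semidirect_int N \<phi>\<^esub> = (\<one>, 0)"
  by (simp add: semidirect_int_def semidirect_product_def)

lemma inv_t_semidirect_int: "inv\<^bsub>semidirect_int N \<phi>\<^esub> (\<one>, 1) = (\<one>, -1)"
proof (rule S.inv_equality)
  have "\<phi> \<one> = \<one>" using \<phi> N hom_one by (auto simp: auto_def)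
  then show "(\<one>, -1) \<otimes>\<^bsub>semidirect_int N \<phi>\<^esub> (\<one>, 1) = \<one>\<^bsub>semidirect_int N \<phi>\<^esub>"
    by (simp add: mult_semidirect_int one_semidirect_int int_pow_auto_1 del: int_pow_0)
qed (auto simp: carrier_semidirect_int)

lemma semidirect_int_relation:
  assumes "a \<in> carrier N"
  shows "inv\<^bsub>semidirect_int N \<phi>\<^esub> (\<one>, 1) \<otimes>\<^bsub>semidirect_int N \<phi>\<^esub> (a, 0)
           \<otimes>\<^bsub>semidirect_int N \<phi>\<^esub> (\<one>, 1) = (\<phi> a, 0)"
proof -
  have "(\<phi> [^]\<^bsub>AutoGroup N\<^esub> (1::int)) a = \<phi> a"
    by (simp only: int_pow_auto_1)
  moreover have "(\<phi> [^]\<^bsub>AutoGroup N\<^esub> (1::int)) \<one> = \<one>"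
    using int_pow_auto_closed[of 1] N hom_one by (auto simp: auto_def)
  ultimately show ?thesis
    using assms auto_closed[OF \<phi> assms] \<phi>
    unfolding inv_t_semidirect_int
    by (auto simp: mult_semidirect_int)
qed

lemma semidirect_int_extend:
  assumes K: "group K" and f: "f \<in> hom N K" and s: "s \<in> carrier K"
    and rel: "\<And>a. a \<in> carrier N \<Longrightarrow> inv\<^bsub>K\<^esub> s \<otimes>\<^bsub>K\<^esub> f a \<otimes>\<^bsub>K\<^esub> s = f (\<phi> a)"
  shows "(\<lambda>(a, i::int). f a \<otimes>\<^bsub>K\<^esub> s [^]\<^bsub>K\<^esub> i) \<in> hom (semidirect_int N \<phi>) K"
proof -
  interpret K: group K by fact
  interpret f: group_hom N K f using f by (simp add: group_hom_def group_hom_axioms_def N K)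
  let ?p = "\<lambda>i::int. \<phi> [^]\<^bsub>AutoGroup N\<^esub> i"
  note cl = auto_closed[OF int_pow_auto_closed]
  have sf: "s \<otimes>\<^bsub>K\<^esub> f (\<phi> a) = f a \<otimes>\<^bsub>K\<^esub> s" if "a \<in> carrier N" for a
    using rel[OF that, symmetric] s f.hom_closed[OF that]
    by (simp add: K.m_assoc[symmetric])
  have up: "f (?p (-1) b) \<otimes>\<^bsub>K\<^esub> s = s \<otimes>\<^bsub>K\<^esub> f b" if b: "b \<in> carrier N" for b
  proof -
    have "\<phi> (?p (-1) b) = b"
      using int_pow_auto_add[OF b, of 1 "-1"] b
      by (simp only: int_pow_auto_1 int_pow_auto_0 add.right_inverse)
    then show ?thesis using sf[OF cl[OF b, of "-1"]] by simp
  qed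
  have down: "f (\<phi> b) \<otimes>\<^bsub>K\<^esub> inv\<^bsub>K\<^esub> s = inv\<^bsub>K\<^esub> s \<otimes>\<^bsub>K\<^esub> f b" if b: "b \<in> carrier N" for b
    using rel[OF b, symmetric] s f.hom_closed[OF b] by (simp add: K.m_assoc)
  have comm: "f (?p (- i) b) \<otimes>\<^bsub>K\<^esub> s [^]\<^bsub>K\<^esub> i = s [^]\<^bsub>K\<^esub> i \<otimes>\<^bsub>K\<^esub> f b"
    if "b \<in> carrier N" for b and i :: int
    using that
  proof (induction i arbitrary: b rule: int_induct[where k = 0])
    case base
    then show ?case by (simp add: int_pow_auto_0 del: int_pow_0) simp
  next
    case (step1 i)
    have "f (?p (- (i + 1)) b) \<otimes>\<^bsub>K\<^esub> s [^]\<^bsub>K\<^esub> (i + 1)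
        = f (?p (- i) (?p (-1) b)) \<otimes>\<^bsub>K\<^esub> s [^]\<^bsub>K\<^esub> i \<otimes>\<^bsub>K\<^esub> s"
      using int_pow_auto_add[OF step1.prems, of "-i" "-1"] s step1.prems
      by (simp add: K.int_pow_mult K.m_assoc cl)
    also have "\<dots> = s [^]\<^bsub>K\<^esub> i \<otimes>\<^bsub>K\<^esub> (f (?p (-1) b) \<otimes>\<^bsub>K\<^esub> s)"
      using step1.IH[OF cl[OF step1.prems]] s step1.prems by (simp add: K.m_assoc cl)
    also have "\<dots> = s [^]\<^bsub>K\<^esub> (i + 1) \<otimes>\<^bsub>K\<^esub> f b"
      using up[OF step1.prems] s step1.prems by (simp add: K.int_pow_mult K.m_assoc)
    finally show ?case .
  next
    case (step2 i)
    have "f (?p (- (i - 1)) b) \<otimes>\<^bsub>K\<^esub> s [^]\<^bsub>K\<^esub> (i - 1)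
        = f (?p (- i) (?p 1 b)) \<otimes>\<^bsub>K\<^esub> s [^]\<^bsub>K\<^esub> i \<otimes>\<^bsub>K\<^esub> inv\<^bsub>K\<^esub> s"
      using int_pow_auto_add[OF step2.prems, of "-i" "1"] s step2.prems
        K.int_pow_mult[OF s, of i "-1"]
      by (simp add: K.m_assoc cl K.int_pow_neg K.int_pow_1)
    also have "\<dots> = s [^]\<^bsub>K\<^esub> i \<otimes>\<^bsub>K\<^esub> (f (\<phi> b) \<otimes>\<^bsub>K\<^esub> inv\<^bsub>K\<^esub> s)"
      unfolding int_pow_auto_1 step2.IH[OF auto_closed[OF \<phi> step2.prems]]
      using s step2.prems by (simp add: K.m_assoc auto_closed[OF \<phi>])
    also have "\<dots> = s [^]\<^bsub>K\<^esub> (i - 1) \<otimes>\<^bsub>K\<^esub> f b"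
      using down[OF step2.prems] s step2.prems K.int_pow_mult[OF s, of i "-1"]
      by (simp add: K.m_assoc K.int_pow_neg K.int_pow_1)
    finally show ?case .
  qed
  show ?thesis
  proof (rule homI)
    fix x y assume "x \<in> carrier (semidirect_int N \<phi>)" "y \<in> carrier (semidirect_int N \<phi>)"
    then obtain a i b j where xy: "x = (a, i)" "y = (b, j)" "a \<in> carrier N" "b \<in> carrier N"
      by (auto simp: carrier_semidirect_int)
    have "f a \<otimes>\<^bsub>K\<^esub> f (?p (- i) b) \<otimes>\<^bsub>K\<^esub> (s [^]\<^bsub>K\<^esub> i \<otimes>\<^bsub>K\<^esub> s [^]\<^bsub>K\<^esub> j)
        = f a \<otimes>\<^bsub>K\<^esub> (f (?p (- i) b) \<otimes>\<^bsub>K\<^esub> s [^]\<^bsub>K\<^esub> i) \<otimes>\<^bsub>K\<^esub> s [^]\<^bsub>K\<^esub> j"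
      using xy s by (simp add: K.m_assoc cl)
    also have "\<dots> = f a \<otimes>\<^bsub>K\<^esub> s [^]\<^bsub>K\<^esub> i \<otimes>\<^bsub>K\<^esub> (f b \<otimes>\<^bsub>K\<^esub> s [^]\<^bsub>K\<^esub> j)"
      unfolding comm[OF xy(4)] using xy s by (simp add: K.m_assoc)
    finally show "(case x \<otimes>\<^bsub>semidirect_int N \<phi>\<^esub> y of (a, i) \<Rightarrow> f a \<otimes>\<^bsub>K\<^esub> s [^]\<^bsub>K\<^esub> i)
        = (case x of (a, i) \<Rightarrow> f a \<otimes>\<^bsub>K\<^esub> s [^]\<^bsub>K\<^esub> i) \<otimes>\<^bsub>K\<^esub> (case y of (a, i) \<Rightarrow> f a \<otimes>\<^bsub>K\<^esub> s [^]\<^bsub>K\<^esub> i)"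
      using xy s by (simp add: mult_semidirect_int K.int_pow_mult cl)
  qed (auto simp: carrier_semidirect_int s)
qed

lemma pow_t_semidirect_int: "(\<one>, 1) [^]\<^bsub>semidirect_int N \<phi>\<^esub> (i::int) = (\<one>, i)"
proof -
  have one: "(\<phi> [^]\<^bsub>AutoGroup N\<^esub> (k::int)) \<one> = \<one>" for k
    using int_pow_auto_closed[of k] N hom_one by (auto simp: auto_def)
  have "(\<lambda>k::int. (\<one>, k)) \<in> hom integer_group (semidirect_int N \<phi>)"
    by (rule homI) (auto simp: carrier_semidirect_int mult_semidirect_int one)
  then interpret h: group_hom integer_group "semidirect_int N \<phi>" "\<lambda>k::int. (\<one>, k)"
    by (simp add: group_hom_def group_hom_axioms_def)
  show ?thesis using h.hom_int_pow[of 1 i] by simp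
qed

lemma generate_semidirect_int:
  assumes S: "S \<subseteq> carrier N" and gen: "generate N S = carrier N"
  shows "generate (semidirect_int N \<phi>) (insert (\<one>, 1) ((\<lambda>a. (a, 0)) ` S))
           = carrier (semidirect_int N \<phi>)" (is "?L = _")
proof
  have sub: "insert (\<one>, 1) ((\<lambda>a. (a, 0)) ` S) \<subseteq> carrier (semidirect_int N \<phi>)"
    using S by (auto simp: carrier_semidirect_int)
  then show "?L \<subseteq> carrier (semidirect_int N \<phi>)" by (rule S.generate_incl)
  have L: "subgroup ?L (semidirect_int N \<phi>)" using sub by (rule S.generate_is_subgroup)
  have "(\<lambda>a. (a, 0::int)) \<in> hom N (semidirect_int N \<phi>)"
    by (rule homI)
      (auto simp: carrier_semidirect_int mult_semidirect_int int_pow_auto_0 simp del: int_pow_0)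
  then interpret h: group_hom N "semidirect_int N \<phi>" "\<lambda>a. (a, 0::int)"
    by (simp add: group_hom_def group_hom_axioms_def N)
  have 0: "(a, 0) \<in> ?L" if "a \<in> carrier N" for a
    using that S.mono_generate[of "(\<lambda>a. (a, 0)) ` S" "insert (\<one>, 1) ((\<lambda>a. (a, 0)) ` S)"]
      h.generate_img[OF S] gen by auto
  have t: "(\<one>, i) \<in> ?L" for i :: int
    using S.subgroup_int_pow_closed[OF L, of "(\<one>, 1)" i]
    by (simp add: pow_t_semidirect_int generate.incl)
  show "carrier (semidirect_int N \<phi>) \<subseteq> ?L"
  proof
    fix x assume "x \<in> carrier (semidirect_int N \<phi>)"
    then obtain a i where x: "x = (a, i)" "a \<in> carrier N" by (auto simp: carrier_semidirect_int)
    have "(a, 0) \<otimes>\<^bsub>semidirect_int N \<phi>\<^esub> (\<one>, i) \<in> ?L"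
      by (intro generate.eng 0 t x)
    then show "x \<in> ?L"
      using x by (simp add: mult_semidirect_int int_pow_auto_0 del: int_pow_0)
  qed
qed

end

text \<open>The next two lemmas, with \<open>semidirect_int_relation\<close>, say that \<open>semidirect_int (free_group n) \<phi>\<close> is presented by
  generators \<open>x\<^sub>0, \<dots>, x\<^sub>n\<^sub>-\<^sub>1, t\<close> and relations \<open>t\<^sup>-\<^sup>1 x\<^sub>i t = \<phi> x\<^sub>i\<close>.\<close>

lemma free_by_cyclic_generate:
  assumes "\<phi> \<in> auto (free_group n)"
  shows "generate (semidirect_int (free_group n) \<phi>)
           (insert (\<one>\<^bsub>free_group n\<^esub>, 1) ((\<lambda>i. (free_gen i, 0)) ` {..<n}))
         = carrier (semidirect_int (free_group n) \<phi>)"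
  using generate_semidirect_int[OF group_free_group assms _ generate_free_group]
  by (auto simp: image_image intro: free_gen_closed)

lemma free_by_cyclic_universal:
  assumes \<phi>: "\<phi> \<in> auto (free_group n)" and K: "group K"
    and y: "\<And>i. i < n \<Longrightarrow> y i \<in> carrier K" and s: "s \<in> carrier K"
    and rel: "\<And>i. i < n \<Longrightarrow> inv\<^bsub>K\<^esub> s \<otimes>\<^bsub>K\<^esub> y i \<otimes>\<^bsub>K\<^esub> s = word_val K y (\<phi> (free_gen i))"
  shows "\<exists>h \<in> hom (semidirect_int (free_group n) \<phi>) K.
           (\<forall>i<n. h (free_gen i, 0) = y i) \<and> h (\<one>\<^bsub>free_group n\<^esub>, 1) = s"
proof -
  interpret K: group K by fact
  let ?f = "word_val K y"
  have f: "?f \<in> hom (free_group n) K" using K y by (rule word_val_hom)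
  interpret f: group_hom "free_group n" K ?f
    using f by (simp add: group_hom_def group_hom_axioms_def group_free_group K)
  have "inv\<^bsub>K\<^esub> s \<otimes>\<^bsub>K\<^esub> ?f a \<otimes>\<^bsub>K\<^esub> s = ?f (\<phi> a)" if "a \<in> carrier (free_group n)" for a
  proof (rule free_group_hom_eq[where f = "\<lambda>a. inv\<^bsub>K\<^esub> s \<otimes>\<^bsub>K\<^esub> ?f a \<otimes>\<^bsub>K\<^esub> s" and g = "\<lambda>a. ?f (\<phi> a)"])
    have *: "s \<otimes>\<^bsub>K\<^esub> (inv\<^bsub>K\<^esub> s \<otimes>\<^bsub>K\<^esub> z) = z" if "z \<in> carrier K" for z
      using that s by (simp add: K.m_assoc[symmetric])
    show "(\<lambda>a. inv\<^bsub>K\<^esub> s \<otimes>\<^bsub>K\<^esub> ?f a \<otimes>\<^bsub>K\<^esub> s) \<in> hom (free_group n) K"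
      by (rule homI) (simp_all add: s K.m_assoc *)
    show "(\<lambda>a. ?f (\<phi> a)) \<in> hom (free_group n) K"
      by (rule homI) (simp_all add: auto_closed[OF \<phi>] auto_mult[OF \<phi>])
  qed (use that rel y in \<open>auto simp: K word_val_free_gen[OF K]\<close>)
  from semidirect_int_extend[OF group_free_group \<phi> K f s this]
  show ?thesis
    using s y f.hom_one
    by (intro bexI[of _ "\<lambda>(a, i::int). ?f a \<otimes>\<^bsub>K\<^esub> s [^]\<^bsub>K\<^esub> i"])
      (auto simp: word_val_free_gen[OF K] K.int_pow_1)
qed


section \<open>Existence and uniqueness of the induced matrix\<close>

lemma comm_group_abelianization: "group G \<Longrightarrow> comm_group (abelianization G)"
  unfolding abelianization_def by (rule group.derived_quot_is_comm_group)

lemma ab_class_hom: "group G \<Longrightarrow> ab_class G \<in> hom G (abelianization G)"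
  using normal.r_coset_hom_Mod[OF group.derived_self_is_normal, of G]
  by (simp add: ab_class_def[abs_def] abelianization_def)

lemma ab_class_surj: "C \<in> carrier (abelianization G) \<Longrightarrow> \<exists>g\<in>carrier G. C = ab_class G g"
  by (auto simp: abelianization_def ab_class_def FactGroup_def RCOSETS_def)

lemma ab_map_ab_class:
  assumes G: "group G" and \<phi>: "\<phi> \<in> auto G" and g: "g \<in> carrier G"
  shows "ab_map \<phi> (ab_class G g) = ab_class G (\<phi> g)"
proof -
  interpret h: group_hom G G \<phi>
    using \<phi> by (simp add: group_hom_def group_hom_axioms_def G auto_def)
  have im: "\<phi> ` carrier G = carrier G" using \<phi> by (auto simp: auto_def Bij_def bij_betw_def)
  have D: "derived G (carrier G) \<subseteq> carrier G"
    by (rule h.G.derived_in_carrier) simp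
  have "\<phi> ` derived G (carrier G) = derived G (carrier G)"
    using h.derived_img[of "carrier G"] im by simp
  moreover have "\<phi> ` (derived G (carrier G) #>\<^bsub>G\<^esub> g) = (\<phi> ` derived G (carrier G)) #>\<^bsub>G\<^esub> \<phi> g"
    using D g by (force simp: r_coset_def image_iff subset_iff)
  ultimately show ?thesis by (simp add: ab_map_def ab_class_def)
qed

text \<open>The exponent sum of \<open>x\<^sub>i\<close> in a word.\<close>

definition exp_sum :: "nat \<Rightarrow> letter list \<Rightarrow> int" where
  "exp_sum i = word_val integer_group (\<lambda>k. if k = i then 1 else 0)"

lemma exp_sum_hom: "exp_sum i \<in> hom (free_group n) integer_group"
  unfolding exp_sum_def by (rule word_val_hom) auto

lemma exp_sum_free_gen: "exp_sum i (free_gen j) = (if j = i then 1 else 0)"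
  unfolding exp_sum_def by (subst word_val_free_gen) auto

definition ab_coord :: "nat \<Rightarrow> letter list set \<Rightarrow> int" where
  "ab_coord i C = the_elem (exp_sum i ` C)"

lemma ab_coord_ab_class:
  assumes w: "w \<in> carrier (free_group n)"
  shows "ab_coord i (ab_class (free_group n) w) = exp_sum i w"
proof -
  let ?F = "free_group n" and ?D = "derived (free_group n) (carrier (free_group n))"
  interpret F: group ?F by (rule group_free_group)
  interpret e: group_hom ?F integer_group "exp_sum i"
    by (simp add: group_hom_def group_hom_axioms_def exp_sum_hom F.is_group)
  have D: "?D \<subseteq> carrier ?F" by (rule F.derived_in_carrier) simp
  have 0: "exp_sum i d = 0" if "d \<in> ?D" for d
    using that unfolding derived_def
  proof (induction rule: generate.induct)
    case (eng a b)
    have "a \<in> carrier ?F" "b \<in> carrier ?F"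
      using eng.hyps D by (auto simp: derived_def)
    with eng show ?case by (simp del: mult_free_group)
  qed (auto simp: e.hom_inv)
  have "exp_sum i x = exp_sum i w" if "x \<in> ab_class ?F w" for x
    using that 0 D w by (auto simp: ab_class_def r_coset_def subset_iff)
  moreover have "w \<in> ab_class ?F w"
    unfolding ab_class_def by (rule F.rcos_self[OF w F.derived_is_subgroup[OF order_refl]])
  ultimately have "exp_sum i ` ab_class ?F w = {exp_sum i w}" by (blast intro: sym)
  then show ?thesis by (simp add: ab_coord_def)
qed

lemma ab_coord_hom: "ab_coord i \<in> hom (abelianization (free_group n)) integer_group"
proof (rule homI)
  interpret F: group "free_group n" by (rule group_free_group)
  interpret c: group_hom "free_group n" "abelianization (free_group n)" "ab_class (free_group n)"
    using ab_class_hom[OF F.is_group] comm_group_abelianization[OF F.is_group]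
    by (simp add: group_hom_def group_hom_axioms_def comm_group_def)
  interpret e: group_hom "free_group n" integer_group "exp_sum i"
    by (simp add: group_hom_def group_hom_axioms_def exp_sum_hom)
  fix C D
  assume C: "C \<in> carrier (abelianization (free_group n))"
    and D: "D \<in> carrier (abelianization (free_group n))"
  obtain u v where uv: "u \<in> carrier (free_group n)" "v \<in> carrier (free_group n)"
    "C = ab_class (free_group n) u" "D = ab_class (free_group n) v" 
    using ab_class_surj[OF C] ab_class_surj[OF D] by blast
  have "ab_coord i (C \<otimes>\<^bsub>abelianization (free_group n)\<^esub> D)
      = ab_coord i (ab_class (free_group n) (u \<otimes>\<^bsub>free_group n\<^esub> v))"
    unfolding uv(3,4) by (simp only: c.hom_mult[OF uv(1,2)])
  also have "\<dots> = ab_coord i C + ab_coord i D"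
    using uv(1,2) unfolding uv(3,4)
    by (simp only: ab_coord_ab_class F.m_closed e.hom_mult mult_integer_group)
  finally show "ab_coord i (C \<otimes>\<^bsub>abelianization (free_group n)\<^esub> D)
      = ab_coord i C \<otimes>\<^bsub>integer_group\<^esub> ab_coord i D" by simp
qed auto

context
  fixes n :: nat
begin

private abbreviation (input) "F \<equiv> free_group n"
private abbreviation (input) "Fab \<equiv> abelianization (free_group n)"
private abbreviation (input) "x \<equiv> \<lambda>i. ab_class (free_group n) (free_gen i)"

interpretation F: group F by (rule group_free_group)
interpretation A: comm_group Fab by (rule comm_group_abelianization[OF group_free_group])
interpretation c: group_hom F Fab "ab_class F"
  by (simp add: group_hom_def group_hom_axioms_def ab_class_hom group_free_group A.is_group)

private lemma x_closed: "i < n \<Longrightarrow> x i \<in> carrier Fab"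
  by (simp add: free_gen_closed)

lemma ab_coord_finprod:
  fixes z :: "nat \<Rightarrow> int"
  assumes k: "k < n"
  shows "ab_coord k (finprod Fab (\<lambda>i. x i [^]\<^bsub>Fab\<^esub> z i) {..<n}) = z k"
proof -
  interpret h: group_hom Fab integer_group "ab_coord k"
    by (simp add: group_hom_def group_hom_axioms_def ab_coord_hom A.is_group)
  have "ab_coord k (finprod Fab (\<lambda>i. x i [^]\<^bsub>Fab\<^esub> z i) {..<m})
      = (\<Sum>i<m. if i = k then z i else 0)" if "m \<le> n" for m
    using that
  proof (induction m)
    case 0
    then show ?case using h.hom_one by simp
  next
    case (Suc m)
    have cl: "x i [^]\<^bsub>Fab\<^esub> z i \<in> carrier Fab" if "i \<le> m" for i
      using that Suc.prems by (simp add: x_closed)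
    have "ab_coord k (x m [^]\<^bsub>Fab\<^esub> z m) = (if m = k then z m else 0)"
      using h.hom_int_pow[OF x_closed[of m], of "z m"] Suc.prems
      by (simp add: ab_coord_ab_class free_gen_closed exp_sum_free_gen)
    moreover have "finprod Fab (\<lambda>i. x i [^]\<^bsub>Fab\<^esub> z i) {..<Suc m}
        = x m [^]\<^bsub>Fab\<^esub> z m \<otimes>\<^bsub>Fab\<^esub> finprod Fab (\<lambda>i. x i [^]\<^bsub>Fab\<^esub> z i) {..<m}"
      unfolding lessThan_Suc by (rule A.finprod_insert) (auto intro: cl)
    moreover have "finprod Fab (\<lambda>i. x i [^]\<^bsub>Fab\<^esub> z i) {..<m} \<in> carrier Fab"
      by (rule A.finprod_closed) (auto intro: cl)
    ultimately show ?case
      using Suc cl[of m] by simp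
  qed
  from this[of n] show ?thesis using k by (simp add: sum.delta)
qed

lemma ab_class_finprod:
  assumes w: "w \<in> carrier F"
  shows "ab_class F w = finprod Fab (\<lambda>i. x i [^]\<^bsub>Fab\<^esub> exp_sum i w) {..<n}"
proof (rule free_group_hom_eq[OF A.is_group ab_class_hom[OF group_free_group] _ _ w])
  have cl: "x i [^]\<^bsub>Fab\<^esub> (m::int) \<in> carrier Fab" if "i < n" for i m
    using that by (simp add: x_closed)
  show "(\<lambda>w. finprod Fab (\<lambda>i. x i [^]\<^bsub>Fab\<^esub> exp_sum i w) {..<n}) \<in> hom F Fab"
  proof (rule homI)
    fix u v assume uv: "u \<in> carrier F" "v \<in> carrier F"
    have "exp_sum i (u \<otimes>\<^bsub>F\<^esub> v) = exp_sum i u + exp_sum i v" for i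
      using hom_mult[OF exp_sum_hom uv, of i] by simp
    then have "finprod Fab (\<lambda>i. x i [^]\<^bsub>Fab\<^esub> exp_sum i (u \<otimes>\<^bsub>F\<^esub> v)) {..<n}
        = finprod Fab (\<lambda>i. x i [^]\<^bsub>Fab\<^esub> exp_sum i u \<otimes>\<^bsub>Fab\<^esub> x i [^]\<^bsub>Fab\<^esub> exp_sum i v) {..<n}"
      by (intro A.finprod_cong) (auto simp: A.int_pow_mult x_closed simp_implies_def intro!: cl)
    then show "finprod Fab (\<lambda>i. x i [^]\<^bsub>Fab\<^esub> exp_sum i (u \<otimes>\<^bsub>F\<^esub> v)) {..<n}
        = finprod Fab (\<lambda>i. x i [^]\<^bsub>Fab\<^esub> exp_sum i u) {..<n} \<otimes>\<^bsub>Fab\<^esub>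
          finprod Fab (\<lambda>i. x i [^]\<^bsub>Fab\<^esub> exp_sum i v) {..<n}"
      by (simp add: A.finprod_multf cl)
  qed (auto intro!: A.finprod_closed cl)
  fix j assume j: "j < n"
  have "finprod Fab (\<lambda>i. x i [^]\<^bsub>Fab\<^esub> exp_sum i (free_gen j)) {..<n}
      = finprod Fab (\<lambda>i. if j = i then x i else \<one>\<^bsub>Fab\<^esub>) {..<n}"
    by (intro A.finprod_cong) (auto simp: exp_sum_free_gen x_closed A.int_pow_1 simp_implies_def)
  also have "\<dots> = x j"
    using j by (intro A.finprod_singleton) (auto simp: x_closed)
  finally show "x j = finprod Fab (\<lambda>i. x i [^]\<^bsub>Fab\<^esub> exp_sum i (free_gen j)) {..<n}" ..
qed

lemma is_ab_matrix_iff: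
  assumes \<phi>: "\<phi> \<in> auto F"
  shows "is_ab_matrix n \<phi> M \<longleftrightarrow> M = mat n n (\<lambda>(i, j). exp_sum i (\<phi> (free_gen j)))"
proof
  have im: "ab_map \<phi> (x j) = ab_class F (\<phi> (free_gen j))" if "j < n" for j
    using ab_map_ab_class[OF group_free_group \<phi>] that by (simp add: free_gen_closed)
  have cl: "\<phi> (free_gen j) \<in> carrier F" if "j < n" for j
    using that auto_closed[OF \<phi>] by (simp add: free_gen_closed)
  {
    assume M: "is_ab_matrix n \<phi> M"
    then have d: "M \<in> carrier_mat n n" by (simp add: is_ab_matrix_def)
    have "M $$ (i, j) = exp_sum i (\<phi> (free_gen j))" if "i < n" "j < n" for i j
    proof -
      have "ab_coord i (ab_map \<phi> (x j))
          = ab_coord i (finprod Fab (\<lambda>i. x i [^]\<^bsub>Fab\<^esub> (M $$ (i, j))) {..<n})"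
        using M that by (simp add: is_ab_matrix_def)
      also have "\<dots> = M $$ (i, j)"
        by (rule ab_coord_finprod[OF that(1), where z = "\<lambda>i. M $$ (i, j)"])
      finally show ?thesis
        using that by (simp add: im ab_coord_ab_class cl)
    qed
    with d show "M = mat n n (\<lambda>(i, j). exp_sum i (\<phi> (free_gen j)))"
      by (intro eq_matI) auto
  next
    assume M: "M = mat n n (\<lambda>(i, j). exp_sum i (\<phi> (free_gen j)))"
    show "is_ab_matrix n \<phi> M"
      unfolding is_ab_matrix_def
    proof (intro conjI allI impI)
      show "M \<in> carrier_mat n n" by (simp add: M)
      fix j assume j: "j < n"
      show "ab_map \<phi> (x j) = finprod Fab (\<lambda>i. x i [^]\<^bsub>Fab\<^esub> (M $$ (i, j))) {..<n}"
        unfolding im[OF j] ab_class_finprod[OF cl[OF j]]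
        by (intro A.finprod_cong) (auto simp: M j x_closed simp_implies_def)
    qed
  }
qed

lemma ex1_ab_matrix: "\<phi> \<in> auto F \<Longrightarrow> \<exists>!M. is_ab_matrix n \<phi> M"
  by (simp add: is_ab_matrix_iff)

lemma ab_matrix_eq:
  "\<phi> \<in> auto F \<Longrightarrow> ab_matrix n \<phi> = mat n n (\<lambda>(i, j). exp_sum i (\<phi> (free_gen j)))"
  by (simp add: ab_matrix_def is_ab_matrix_iff)

end


section \<open>Target groups of arbitrary type\<close>

lemma one_lower_central: "group G \<Longrightarrow> \<one>\<^bsub>G\<^esub> \<in> lower_central G k"
  by (cases k) (auto intro: generate.one simp: group.is_monoid)

lemma lower_central_subset: "group G \<Longrightarrow> lower_central G k \<subseteq> carrier G"
proof (induction k)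
  case (Suc k)
  interpret group G by fact
  have "lower_central G k \<subseteq> carrier G" using Suc by simp
  then show ?case
    unfolding lower_central.simps by (intro generate_incl) (auto dest: subsetD)
qed simp

lemma hom_lower_central:
  assumes "group G" "group K" "h \<in> hom G K"
  shows "h ` lower_central G k \<subseteq> lower_central K k"
proof (induction k)
  case 0
  then show ?case using assms(3) by (auto simp: hom_def)
next
  case (Suc k)
  interpret h: group_hom G K h using assms by (simp add: group_hom_def group_hom_axioms_def)
  let ?c = "\<lambda>G k. \<Union>h \<in> lower_central G k. \<Union>g \<in> carrier G.
    {h \<otimes>\<^bsub>G\<^esub> g \<otimes>\<^bsub>G\<^esub> inv\<^bsub>G\<^esub> h \<otimes>\<^bsub>G\<^esub> inv\<^bsub>G\<^esub> g}"
  note sub = lower_central_subset[OF assms(1), of k, THEN subsetD]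
  have c: "?c G k \<subseteq> carrier G" by (auto dest!: sub)
  have "h ` ?c G k \<subseteq> (\<Union>h \<in> lower_central K k. \<Union>g \<in> carrier K.
    {h \<otimes>\<^bsub>K\<^esub> g \<otimes>\<^bsub>K\<^esub> inv\<^bsub>K\<^esub> h \<otimes>\<^bsub>K\<^esub> inv\<^bsub>K\<^esub> g})"
  proof
    fix z assume "z \<in> h ` ?c G k"
    then obtain a g where ag: "a \<in> lower_central G k" "g \<in> carrier G"
      "z = h (a \<otimes>\<^bsub>G\<^esub> g \<otimes>\<^bsub>G\<^esub> inv\<^bsub>G\<^esub> a \<otimes>\<^bsub>G\<^esub> inv\<^bsub>G\<^esub> g)" by auto
    have "z = h a \<otimes>\<^bsub>K\<^esub> h g \<otimes>\<^bsub>K\<^esub> inv\<^bsub>K\<^esub> h a \<otimes>\<^bsub>K\<^esub> inv\<^bsub>K\<^esub> h g"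
      using ag sub[OF ag(1)] by simp
    moreover have "h a \<in> lower_central K k" "h g \<in> carrier K" using ag Suc by auto
    ultimately show "z \<in> (\<Union>h \<in> lower_central K k. \<Union>g \<in> carrier K.
      {h \<otimes>\<^bsub>K\<^esub> g \<otimes>\<^bsub>K\<^esub> inv\<^bsub>K\<^esub> h \<otimes>\<^bsub>K\<^esub> inv\<^bsub>K\<^esub> g})" by blast
  qed
  then show ?case
    unfolding lower_central.simps h.generate_img[OF c, symmetric] by (rule h.H.mono_generate)
qed

lemma nilpotent_group_inj:
  assumes G: "group G" and K: "nilpotent_group K" and h: "h \<in> hom G K" "inj_on h (carrier G)"
  shows "nilpotent_group G"
proof -
  from K obtain k where k: "group K" "lower_central K k = {\<one>\<^bsub>K\<^esub>}"
    by (auto simp: nilpotent_group_def)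
  have "a = \<one>\<^bsub>G\<^esub>" if "a \<in> lower_central G k" for a
  proof -
    have "h a = h \<one>\<^bsub>G\<^esub>"
      using that hom_lower_central[OF G k(1) h(1), of k] k(2) hom_one[OF h(1) G k(1)] by auto
    then show ?thesis
      using h(2) that lower_central_subset[OF G, of k] G
      by (auto simp: inj_on_def group.is_monoid)
  qed
  then have "lower_central G k = {\<one>\<^bsub>G\<^esub>}"
    using one_lower_central[OF G, of k] by blast
  with G show ?thesis unfolding nilpotent_group_def by blast
qed

lemma quotient_target:
  fixes G :: "('a, 'b) monoid_scheme"
  assumes "group G" "group K" "h \<in> hom G K" "g \<in> carrier G" "h g \<noteq> \<one>\<^bsub>K\<^esub>"
  shows "\<exists>(L :: 'a set monoid) f e. group L \<and> f \<in> hom G L \<and> f g \<noteq> \<one>\<^bsub>L\<^esub> \<and>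
           e \<in> hom L K \<and> inj_on e (carrier L)"
proof -
  interpret h: group_hom G K h using assms by (simp add: group_hom_def group_hom_axioms_def)
  interpret N: normal "kernel G K h" G by (rule h.normal_kernel)
  have "g \<in> kernel G K h #>\<^bsub>G\<^esub> g" by (rule h.G.rcos_self[OF assms(4) N.subgroup_axioms])
  moreover have "g \<notin> kernel G K h" using assms(5) unfolding kernel_def by blast
  ultimately have "kernel G K h #>\<^bsub>G\<^esub> g \<noteq> kernel G K h" by metis
  then have "group (G Mod kernel G K h) \<and>
      (\<lambda>a. kernel G K h #>\<^bsub>G\<^esub> a) \<in> hom G (G Mod kernel G K h) \<and>
      (\<lambda>a. kernel G K h #>\<^bsub>G\<^esub> a) g \<noteq> \<one>\<^bsub>G Mod kernel G K h\<^esub> \<and>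
      (\<lambda>X. the_elem (h ` X)) \<in> hom (G Mod kernel G K h) K \<and>
      inj_on (\<lambda>X. the_elem (h ` X)) (carrier (G Mod kernel G K h))"
    by (intro conjI N.factorgroup_is_group N.r_coset_hom_Mod h.FactGroup_hom h.FactGroup_inj_on)
      (simp only: one_FactGroup not_False_eq_True)
  then show ?thesis by (intro exI)
qed

lemma nilpotent_target_any_type:
  fixes G :: "('a, 'b) monoid_scheme" and K :: "('c, 'd) monoid_scheme"
  assumes "group G" "nilpotent_group K" "h \<in> hom G K" "g \<in> carrier G" "h g \<noteq> \<one>\<^bsub>K\<^esub>"
  shows "\<exists>(L :: 'a set monoid) f. nilpotent_group L \<and> f \<in> hom G L \<and> f g \<noteq> \<one>\<^bsub>L\<^esub>"
proof -
  have "group K" using assms(2) by (simp add: nilpotent_group_def)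
  then obtain L :: "'a set monoid" and f e where L: "group L" "f \<in> hom G L" "f g \<noteq> \<one>\<^bsub>L\<^esub>"
    "e \<in> hom L K" "inj_on e (carrier L)"
    using quotient_target[OF assms(1) _ assms(3-5)] by blast
  from nilpotent_group_inj[OF L(1) assms(2) L(4,5)] L(2,3) show ?thesis by blast
qed

lemma finite_p_target_any_type:
  fixes G :: "('a, 'b) monoid_scheme" and K :: "('c, 'd) monoid_scheme"
  assumes "group G" "prime p" "finite_p_group p K" "h \<in> hom G K" "g \<in> carrier G"
    "h g \<noteq> \<one>\<^bsub>K\<^esub>"
  shows "\<exists>(L :: 'a set monoid) f. finite_p_group p L \<and> f \<in> hom G L \<and> f g \<noteq> \<one>\<^bsub>L\<^esub>"
proof -
  obtain k where K: "group K" "finite (carrier K)" "Coset.order K = p ^ k"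
    using assms(3) by (auto simp: finite_p_group_def)
  obtain L :: "'a set monoid" and f e where L: "group L" "f \<in> hom G L" "f g \<noteq> \<one>\<^bsub>L\<^esub>"
    "e \<in> hom L K" "inj_on e (carrier L)"
    using quotient_target[OF assms(1) K(1) assms(4-6)] by blast
  interpret e: group_hom L K e using L K by (simp add: group_hom_def group_hom_axioms_def)
  have sub: "subgroup (e ` carrier L) K" by (rule e.img_is_subgroup)
  have card: "card (e ` carrier L) = Coset.order L"
    using card_image[OF L(5)] by (simp add: Coset.order_def)
  have "finite (carrier L)"
    using finite_imageD[OF finite_subset[OF subgroup.subset[OF sub] K(2)] L(5)] .
  moreover have "Coset.order L dvd p ^ k"
    using group.lagrange[OF K(1) sub] K(3) card by (metis dvd_triv_right)
  then have "\<exists>l. Coset.order L = p ^ l"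
    using assms(2) divides_primepow_nat by blast
  ultimately show ?thesis using L by (auto simp: finite_p_group_def)
qed

end

theory Submission
  imports Defs
    "HOL-Algebra.Multiplicative_Group"
    "HOL-Algebra.Sylow"
    "HOL-Number_Theory.Cong"
    "Jordan_Normal_Form.Schur_Decomposition"
begin

text \<open>
  Call a function \<open>f\<close> from a group to the integers polynomial of degree below \<open>d\<close> modulo \<open>p\<close> if all
  \<open>d\<close>-fold left differences of \<open>f\<close> vanish modulo \<open>p\<close>. On a finitely generated group there are,
  modulo \<open>p\<close>, only finitely many such functions for given \<open>d\<close>, and left translations act
  unipotently on them, so a group whose points are separated by polynomial functions is residually a
  finite \<open>p\<close>-group. The free group is separated by its Magnus coefficients.

  If the matrix \<open>M\<close> of \<open>\<phi>\<close> satisfies \<open>M\<^sup>q \<equiv> 1\<close> modulo \<open>p\<close> for a power \<open>q\<close> of \<open>p\<close>, then \<open>\<phi>\<^sup>q - 1\<close>, which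
  is congruent to \<open>(\<phi> - 1)\<^sup>q\<close>, lowers the degree of polynomial functions on the free group, so these stay
  polynomial when they are extended to \<open>G\<close> by \<open>w t\<^sup>i \<mapsto> f w\<close>. Integer eigenvalues of an invertible
  integer matrix are \<open>1\<close> or \<open>-1\<close>. Hence \<open>M\<^sup>2\<close> is unipotent and \<open>p = 2\<close> always works; if \<open>M\<close> itself is
  unipotent, every \<open>p\<close> works.
\<close>

section \<open>Differences along a self-map\<close>

definition diff_along :: "('a \<Rightarrow> 'a) \<Rightarrow> ('a \<Rightarrow> int) \<Rightarrow> 'a \<Rightarrow> int" where
  "diff_along \<sigma> f = (\<lambda>x. f (\<sigma> x) - f x)"

lemma diff_along_add: "diff_along \<sigma> (\<lambda>x. f x + h x) = (\<lambda>x. diff_along \<sigma> f x + diff_along \<sigma> h x)"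
  by (simp add: diff_along_def fun_eq_iff)

lemma diff_along_pow_add:
  "(diff_along \<sigma> ^^ k) (\<lambda>x. f x + h x) = (\<lambda>x. (diff_along \<sigma> ^^ k) f x + (diff_along \<sigma> ^^ k) h x)"
  by (induction k) (simp_all add: diff_along_add)

text \<open>Newton's forward difference formula: composition with \<sigma> is the operator
  \<open>1 + diff_along \<sigma>\<close>, whose powers expand binomially. The induction step applies
  the hypothesis to the shifted function and ends with Pascal's rule.\<close>

lemma newton_forward:
  "f ((\<sigma> ^^ j) x) = (\<Sum>k\<le>j. int (j choose k) * (diff_along \<sigma> ^^ k) f x)"
proof (induction j arbitrary: f)
  case (Suc j)
  let ?D = "\<lambda>k. (diff_along \<sigma> ^^ k) f x"
  have "f ((\<sigma> ^^ Suc j) x) = (\<Sum>k\<le>j. int (j choose k) * (diff_along \<sigma> ^^ k) (\<lambda>y. f (\<sigma> y)) x)"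
    using Suc[of "\<lambda>y. f (\<sigma> y)"] by simp
  also have "\<dots> = (\<Sum>k\<le>j. int (j choose k) * (?D k + ?D (Suc k)))"
  proof (rule sum.cong[OF refl])
    fix k
    have "(\<lambda>y. f (\<sigma> y)) = (\<lambda>y. f y + diff_along \<sigma> f y)"
      by (simp add: diff_along_def)
    then have "(diff_along \<sigma> ^^ k) (\<lambda>y. f (\<sigma> y)) x = ?D k + ?D (Suc k)"
      unfolding funpow_Suc_right by (simp only: diff_along_pow_add o_apply)
    then show "int (j choose k) * (diff_along \<sigma> ^^ k) (\<lambda>y. f (\<sigma> y)) x
        = int (j choose k) * (?D k + ?D (Suc k))" by simp
  qed
  also have "\<dots> = (\<Sum>k\<le>Suc j. int (j choose k) * ?D k) + (\<Sum>k\<le>j. int (j choose k) * ?D (Suc k))"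
    by (simp add: distrib_left sum.distrib binomial_eq_0 del: funpow.simps)
  also have "\<dots> = ?D 0 + ((\<Sum>k\<le>j. int (j choose Suc k) * ?D (Suc k))
      + (\<Sum>k\<le>j. int (j choose k) * ?D (Suc k)))"
    by (simp only: sum.atMost_Suc_shift[of _ j]) simp
  also have "\<dots> = ?D 0 + (\<Sum>k\<le>j. int (Suc j choose Suc k) * ?D (Suc k))"
    by (simp only: binomial_Suc_Suc of_nat_add distrib_right sum.distrib add_ac)
  also have "\<dots> = (\<Sum>k\<le>Suc j. int (Suc j choose k) * ?D k)"
    by (simp only: sum.atMost_Suc_shift[of _ j]) simp
  finally show ?case .
qed simp

text \<open>Since \<open>k * (p ^ m choose k) = p ^ m * (p ^ m - 1 choose (k - 1))\<close>, a
  coefficient prime to \<open>p\<close> would force \<open>p ^ m\<close> to divide the smaller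
  positive number \<open>k\<close>.\<close>

lemma prime_dvd_choose_prime_power:
  assumes p: "prime (p::nat)" and k: "0 < k" "k < p ^ m"
  shows "p dvd (p ^ m choose k)"
proof (rule ccontr)
  assume "\<not> p dvd (p ^ m choose k)"
  then have "coprime (p ^ m) (p ^ m choose k)"
    using p by (simp add: prime_imp_coprime)
  moreover have "k * (p ^ m choose k) = p ^ m * (p ^ m - 1 choose (k - 1))"
    using k by (intro times_binomial_minus1_eq)
  then have "p ^ m dvd k * (p ^ m choose k)" by simp
  ultimately have "p ^ m dvd k" by (simp add: coprime_dvd_mult_left_iff)
  then show False using k by (auto dest: dvd_imp_le)
qed

text \<open>Only the two extreme terms of Newton's formula survive modulo \<open>p\<close>; in
  operator form, \<open>(1 + D)^q\<close> is congruent to \<open>1 + D^q\<close>.\<close>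

lemma diff_along_prime_power:
  fixes p :: nat
  assumes p: "prime p" and q: "q = p ^ m"
  shows "[f ((\<sigma> ^^ q) x) = f x + (diff_along \<sigma> ^^ q) f x] (mod int p)"
proof -
  have q0: "q > 0" using p by (simp add: q prime_gt_0_nat)
  let ?t = "\<lambda>k. int (q choose k) * (diff_along \<sigma> ^^ k) f x"
  have "(\<Sum>k\<le>q. ?t k) = ?t 0 + (\<Sum>k\<in>{1..<q}. ?t k) + ?t q"
  proof -
    have "{..q} = insert 0 (insert q {1..<q})" using q0 by auto
    then show ?thesis using q0 by simp
  qed
  moreover have "int p dvd (\<Sum>k\<in>{1..<q}. ?t k)"
    using prime_dvd_choose_prime_power[OF p] by (intro dvd_sum dvd_mult2) (auto simp: q)
  ultimately show ?thesis
    by (auto simp: newton_forward[of f q \<sigma> x] cong_iff_dvd_diff)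
qed

section \<open>Polynomial functions on a group\<close>

text \<open>The index is a strict degree bound: on a group, level 0 consists of the functions
  vanishing modulo \<open>p\<close>, level 1 of those constant modulo \<open>p\<close>.\<close>

primrec poly_fun :: "('a, 'b) monoid_scheme \<Rightarrow> int \<Rightarrow> nat \<Rightarrow> ('a \<Rightarrow> int) set" where
  "poly_fun G p 0 = {f. \<forall>x\<in>carrier G. p dvd f x}"
| "poly_fun G p (Suc d) = {f. \<forall>g\<in>carrier G. diff_along ((\<otimes>\<^bsub>G\<^esub>) g) f \<in> poly_fun G p d}"

lemma poly_fun_diff: "f \<in> poly_fun G p d \<Longrightarrow> h \<in> poly_fun G p d \<Longrightarrow> (\<lambda>x. f x - h x) \<in> poly_fun G p d"
proof (induction d arbitrary: f h)
  case (Suc d)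
  have "diff_along \<sigma> (\<lambda>x. f x - h x) = (\<lambda>x. diff_along \<sigma> f x - diff_along \<sigma> h x)" for \<sigma>
    by (simp add: diff_along_def fun_eq_iff)
  then show ?case using Suc by simp
qed auto

lemma zero_poly_fun: "(\<lambda>x. 0) \<in> poly_fun G p d"
  by (induction d) (auto simp: diff_along_def)

lemma poly_fun_add: "f \<in> poly_fun G p d \<Longrightarrow> h \<in> poly_fun G p d \<Longrightarrow> (\<lambda>x. f x + h x) \<in> poly_fun G p d"
  using poly_fun_diff[OF _ poly_fun_diff[OF zero_poly_fun]] by fastforce

lemma poly_fun_cmult: "f \<in> poly_fun G p d \<Longrightarrow> (\<lambda>x. c * f x) \<in> poly_fun G p d"
proof (induction d arbitrary: f)
  case (Suc d)
  have "diff_along \<sigma> (\<lambda>x. c * f x) = (\<lambda>x. c * diff_along \<sigma> f x)" for \<sigma>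
    by (simp add: diff_along_def algebra_simps)
  then show ?case using Suc by simp
qed auto

context group
begin

lemma poly_fun_0_subset: "f \<in> poly_fun G p 0 \<Longrightarrow> f \<in> poly_fun G p d"
proof (induction d arbitrary: f)
  case (Suc d)
  have "diff_along ((\<otimes>) g) f \<in> poly_fun G p 0" if "g \<in> carrier G" for g
    using that Suc.prems by (auto simp: diff_along_def)
  then show ?case using Suc.IH by simp
qed simp

lemma poly_fun_cong_mod:
  assumes f: "f \<in> poly_fun G p d" and eq: "\<And>x. x \<in> carrier G \<Longrightarrow> [f x = h x] (mod p)"
  shows "h \<in> poly_fun G p d"
proof -
  have "(\<lambda>x. f x - h x) \<in> poly_fun G p 0"
    using eq by (auto simp: cong_iff_dvd_diff)
  from poly_fun_diff[OF f poly_fun_0_subset[OF this]] show ?thesis by simp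
qed

lemma poly_fun_cong:
  "f \<in> poly_fun G p d \<Longrightarrow> (\<And>x. x \<in> carrier G \<Longrightarrow> f x = h x) \<Longrightarrow> h \<in> poly_fun G p d"
  by (erule poly_fun_cong_mod) simp

lemma poly_fun_Suc: "f \<in> poly_fun G p d \<Longrightarrow> f \<in> poly_fun G p (Suc d)"
proof (induction d arbitrary: f)
  case 0
  then show ?case by (rule poly_fun_0_subset)
next
  case (Suc d)
  then show ?case unfolding poly_fun.simps(2)[of G p "Suc d"] by simp
qed

lemma poly_fun_mono: "f \<in> poly_fun G p d \<Longrightarrow> d \<le> e \<Longrightarrow> f \<in> poly_fun G p e"
  by (induction e) (metis le_zero_eq, metis le_Suc_eq poly_fun_Suc)

lemma poly_fun_diff_along:
  "f \<in> poly_fun G p d \<Longrightarrow> g \<in> carrier G \<Longrightarrow> diff_along ((\<otimes>) g) f \<in> poly_fun G p d"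
  using poly_fun_Suc by fastforce

lemma poly_fun_translate:
  assumes "f \<in> poly_fun G p d" "g \<in> carrier G"
  shows "(\<lambda>x. f (g \<otimes> x)) \<in> poly_fun G p d"
  using poly_fun_add[OF assms(1) poly_fun_diff_along[OF assms]] by (simp add: diff_along_def)

lemma poly_fun_hom:
  assumes "s \<in> hom G H"
  shows "f \<in> poly_fun H p d \<Longrightarrow> (\<lambda>x. f (s x)) \<in> poly_fun G p d"
proof (induction d arbitrary: f)
  case 0
  then show ?case using assms by (auto simp: hom_in_carrier)
next
  case (Suc d)
  have "diff_along ((\<otimes>) g) (\<lambda>x. f (s x)) \<in> poly_fun G p d" if g: "g \<in> carrier G" for g
  proof (rule poly_fun_cong)
    show "(\<lambda>x. diff_along ((\<otimes>\<^bsub>H\<^esub>) (s g)) f (s x)) \<in> poly_fun G p d"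
      using Suc assms g by (simp add: hom_in_carrier)
  qed (use g assms in \<open>simp add: diff_along_def hom_mult\<close>)
  then show ?case by simp
qed

text \<open>Write \<open>D_g\<close> for the left difference along \<open>g\<close>. Then
  \<open>D_(gh) f (x) = D_g f (hx) + D_h f (x)\<close> and
  \<open>D_(inv g) f (x) = - D_g f (inv g x)\<close>, and translations preserve the degree bound.
  This allows polynomiality to be tested on generators.\<close>

lemma subgroup_poly_fun_diff:
  "subgroup {g \<in> carrier G. diff_along ((\<otimes>) g) f \<in> poly_fun G p d} G"
proof (rule subgroupI)
  let ?D = "\<lambda>g. diff_along ((\<otimes>) g) f"
  show "{g \<in> carrier G. ?D g \<in> poly_fun G p d} \<noteq> {}"
    using poly_fun_cong[OF zero_poly_fun, of "?D \<one>"] by (auto simp: diff_along_def)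
  fix g assume g: "g \<in> {g \<in> carrier G. ?D g \<in> poly_fun G p d}"
  have "(\<lambda>x. 0 - ?D g (inv g \<otimes> x)) \<in> poly_fun G p d"
    using g by (intro poly_fun_diff zero_poly_fun poly_fun_translate) auto
  then have "?D (inv g) \<in> poly_fun G p d"
    by (rule poly_fun_cong) (use g in \<open>simp add: diff_along_def m_assoc[symmetric]\<close>)
  then show "inv g \<in> {g \<in> carrier G. ?D g \<in> poly_fun G p d}"
    using g by simp
  fix h assume h: "h \<in> {g \<in> carrier G. ?D g \<in> poly_fun G p d}"
  have "(\<lambda>x. ?D g (h \<otimes> x) + ?D h x) \<in> poly_fun G p d"
    using g h by (intro poly_fun_add poly_fun_translate) auto
  then have "?D (g \<otimes> h) \<in> poly_fun G p d"
    by (rule poly_fun_cong) (use g h in \<open>simp add: diff_along_def m_assoc\<close>)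
  then show "g \<otimes> h \<in> {g \<in> carrier G. ?D g \<in> poly_fun G p d}"
    using g h by simp
qed auto

lemma poly_fun_generators:
  assumes gen: "generate G S = carrier G"
    and S: "\<And>s. s \<in> S \<Longrightarrow> s \<in> carrier G \<and> diff_along ((\<otimes>) s) f \<in> poly_fun G p d"
  shows "f \<in> poly_fun G p (Suc d)"
  using generate_subgroup_incl[OF _ subgroup_poly_fun_diff[of f p d], of S] S gen by auto

text \<open>Each difference along \<open>g\<close> lowers the degree bound by one, so the
  \<open>p ^ m\<close>-fold difference vanishes modulo \<open>p\<close>. By
  \<open>diff_along_prime_power\<close> it is the change of \<open>f\<close> under translation by
  the \<open>p ^ m\<close>-th power of \<open>g\<close>.\<close>

lemma poly_fun_pow:
  fixes p :: nat
  assumes p: "prime p" and f: "f \<in> poly_fun G (int p) d" and d: "d \<le> p ^ m"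
    and g: "g \<in> carrier G" and x: "x \<in> carrier G"
  shows "[f (g [^] (p ^ m) \<otimes> x) = f x] (mod int p)"
proof -
  \<comment> \<open>Truncated subtraction keeps the level at 0 once \<open>j\<close> has reached
    \<open>d\<close>.\<close>
  have it: "(diff_along ((\<otimes>) g) ^^ j) f \<in> poly_fun G (int p) (d - j)" for j
  proof (induction j)
    case (Suc j)
    show ?case
    proof (cases "d - j")
      case 0
      then show ?thesis using poly_fun_diff_along[OF Suc g] by simp
    next
      case (Suc e)
      then have "d - Suc j = e" by simp
      then show ?thesis using \<open>_ \<in> poly_fun G (int p) (d - j)\<close> g Suc by simp
    qed
  qed (use f in simp)
  have pw: "(((\<otimes>) g) ^^ j) x = g [^] j \<otimes> x" for j :: nat
  proof (induction j)
    case (Suc j)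
    have "g [^] Suc j = g \<otimes> g [^] j" using g by (rule nat_pow_Suc2)
    then show ?case using Suc g x by (simp add: m_assoc del: nat_pow_Suc)
  qed (use x in simp)
  have "int p dvd (diff_along ((\<otimes>) g) ^^ (p ^ m)) f x"
    using it[of "p ^ m"] d x by simp
  then have "[f x + (diff_along ((\<otimes>) g) ^^ (p ^ m)) f x = f x] (mod int p)"
    by (simp add: cong_iff_dvd_diff)
  with diff_along_prime_power[OF p refl, where f = f and \<sigma> = "(\<otimes>) g" and x = x] show ?thesis
    by (simp add: pw) (rule cong_trans)
qed

end

section \<open>Finiteness modulo \<open>p\<close> and the action by left translations\<close>

lemma finite_image_factor:
  assumes fin: "finite (c ` A)" and eq: "\<And>x y. x \<in> A \<Longrightarrow> y \<in> A \<Longrightarrow> c x = c y \<Longrightarrow> h x = h y"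
  shows "finite (h ` A)"
proof -
  have "h x = h (inv_into A c (c x))" if "x \<in> A" for x
    using that by (intro eq) (auto intro: inv_into_into f_inv_into_f[symmetric])
  then have "h ` A \<subseteq> (\<lambda>y. h (inv_into A c y)) ` c ` A" by blast
  then show ?thesis using fin by (meson finite_imageI finite_subset)
qed

context group
begin

lemma finite_poly_fun_reductions:
  assumes p: "p > 0" and gen: "generate G S = carrier G" and S: "finite S" "S \<subseteq> carrier G"
  shows "finite ((\<lambda>f. restrict (\<lambda>x. f x mod p) (carrier G)) ` poly_fun G p d)"
    (is "finite (?r ` _)")
proof (induction d)
  case 0
  have "?r ` poly_fun G p 0 \<subseteq> {\<lambda>x\<in>carrier G. 0}"
    by (auto simp: fun_eq_iff restrict_def)
  then show ?case by (rule finite_subset) simp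
next
  case (Suc d)
  \<comment> \<open>A function of degree at most \<open>d\<close> is determined by its value at \<open>\<one>\<close> and its differences along
    the generators.\<close>
  let ?code = "\<lambda>f. (f \<one> mod p, \<lambda>s\<in>S. ?r (diff_along ((\<otimes>) s) f))"
  have eq: "?r f = ?r h"
    if fh: "f \<in> poly_fun G p (Suc d)" "h \<in> poly_fun G p (Suc d)" "?code f = ?code h" for f h
  proof -
    have "diff_along ((\<otimes>) s) (\<lambda>x. f x - h x) \<in> poly_fun G p 0" if s: "s \<in> S" for s
    proof -
      have "?r (diff_along ((\<otimes>) s) f) = ?r (diff_along ((\<otimes>) s) h)"
        using fun_cong[OF arg_cong[OF fh(3), of snd], of s] s by simp
      then have "[diff_along ((\<otimes>) s) f x = diff_along ((\<otimes>) s) h x] (mod p)" if "x \<in> carrier G" for x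
        using that by (auto simp: cong_def dest!: fun_cong[of _ _ x])
      moreover have "diff_along ((\<otimes>) s) (\<lambda>x. f x - h x) x
          = diff_along ((\<otimes>) s) f x - diff_along ((\<otimes>) s) h x" for x
        by (simp add: diff_along_def)
      ultimately show ?thesis by (simp add: cong_iff_dvd_diff)
    qed
    \<comment> \<open>The differences of \<open>f - h\<close> along the generators vanish modulo
      \<open>p\<close>, so \<open>f - h\<close> is constant modulo \<open>p\<close>; the first
      component of the code makes this constant zero.\<close>
    with S have "(\<lambda>x. f x - h x) \<in> poly_fun G p (Suc 0)"
      by (intro poly_fun_generators[OF gen]) auto
    then have "diff_along ((\<otimes>) x) (\<lambda>x. f x - h x) \<in> poly_fun G p 0" if "x \<in> carrier G" for x
      using that unfolding poly_fun.simps(2) by blast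
    then have "p dvd f x - h x - (f \<one> - h \<one>)" if "x \<in> carrier G" for x
      using that by (fastforce simp: diff_along_def dest: bspec[of _ _ \<one>])
    moreover have "p dvd f \<one> - h \<one>"
      using fh(3) by (simp add: mod_eq_dvd_iff)
    ultimately have "f x mod p = h x mod p" if "x \<in> carrier G" for x
      using that by (metis dvd_add diff_add_cancel mod_eq_dvd_iff)
    then show "?r f = ?r h" by (simp add: restrict_def fun_eq_iff)
  qed
  have "?code ` poly_fun G p (Suc d) \<subseteq> {0..<p} \<times> (\<Pi>\<^sub>E s\<in>S. ?r ` poly_fun G p d)"
    using p S by auto
  then have fin: "finite (?code ` poly_fun G p (Suc d))"
    by (rule finite_subset) (intro finite_cartesian_product finite_PiE S Suc, simp)
  from fin show ?case by (rule finite_image_factor) (rule eq)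
qed

text \<open>The kernel of the action of \<open>G\<close> on \<open>poly_fun G p d\<close> modulo
  \<open>p\<close> by left translations. The quotient by it is the target group that is used
  throughout.\<close>

definition poly_kernel :: "int \<Rightarrow> nat \<Rightarrow> 'a set" where
  "poly_kernel p d =
     {g \<in> carrier G. \<forall>f\<in>poly_fun G p d. \<forall>x\<in>carrier G. [f (g \<otimes> x) = f x] (mod p)}"

lemma poly_kernelD:
  "g \<in> poly_kernel p d \<Longrightarrow> f \<in> poly_fun G p d \<Longrightarrow> x \<in> carrier G \<Longrightarrow> [f (g \<otimes> x) = f x] (mod p)"
  by (simp add: poly_kernel_def)

lemma poly_kernelI:
  "g \<in> carrier G \<Longrightarrow> (\<And>f x. f \<in> poly_fun G p d \<Longrightarrow> x \<in> carrier G \<Longrightarrow> [f (g \<otimes> x) = f x] (mod p))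
    \<Longrightarrow> g \<in> poly_kernel p d"
  by (simp add: poly_kernel_def)

text \<open>For conjugation by \<open>h\<close>, the kernel condition is applied to the translate of
  \<open>f\<close> by \<open>h\<close>, which has the same degree bound.\<close>

lemma normal_poly_kernel: "poly_kernel p d \<lhd> G"
  unfolding normal_inv_iff
proof (intro conjI ballI)
  have sub: "poly_kernel p d \<subseteq> carrier G" by (auto simp: poly_kernel_def)
  show "subgroup (poly_kernel p d) G"
  proof (rule subgroupI[OF sub])
    show "poly_kernel p d \<noteq> {}" by (auto simp: poly_kernel_def intro!: exI[of _ \<one>])
    fix g assume g: "g \<in> poly_kernel p d"
    then have gc: "g \<in> carrier G" using sub by auto
    show "inv g \<in> poly_kernel p d"
    proof (rule poly_kernelI)
      fix f x assume f: "f \<in> poly_fun G p d" and x: "x \<in> carrier G"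
      have "[f (g \<otimes> (inv g \<otimes> x)) = f (inv g \<otimes> x)] (mod p)"
        by (rule poly_kernelD[OF g f]) (use gc x in simp)
      then show "[f (inv g \<otimes> x) = f x] (mod p)"
        using gc x by (simp add: m_assoc[symmetric] cong_sym_eq)
    qed (use gc in simp)
    fix h assume h: "h \<in> poly_kernel p d"
    then have hc: "h \<in> carrier G" using sub by auto
    show "g \<otimes> h \<in> poly_kernel p d"
    proof (rule poly_kernelI)
      fix f x assume f: "f \<in> poly_fun G p d" and x: "x \<in> carrier G"
      have "[f (g \<otimes> (h \<otimes> x)) = f x] (mod p)"
        using cong_trans[OF poly_kernelD[OF g f] poly_kernelD[OF h f x]] hc x by simp
      then show "[f (g \<otimes> h \<otimes> x) = f x] (mod p)"
        using gc hc x by (simp add: m_assoc)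
    qed (use gc hc in simp)
  qed
  fix h g assume h: "h \<in> carrier G" and g: "g \<in> poly_kernel p d"
  then have gc: "g \<in> carrier G" using sub by auto
  show "h \<otimes> g \<otimes> inv h \<in> poly_kernel p d"
  proof (rule poly_kernelI)
    fix f x assume f: "f \<in> poly_fun G p d" and x: "x \<in> carrier G"
    have "[f (h \<otimes> (g \<otimes> (inv h \<otimes> x))) = f (h \<otimes> (inv h \<otimes> x))] (mod p)"
      by (rule poly_kernelD[OF g poly_fun_translate[OF f h]]) (use h x in simp)
    then show "[f (h \<otimes> g \<otimes> inv h \<otimes> x) = f x] (mod p)"
      using gc h x by (simp add: m_assoc) (simp add: m_assoc[symmetric])
  qed (use gc h in simp)
qed

text \<open>A coset is determined by the self-map that its representative induces on the finite set
  \<open>?Q\<close> of reduced functions: if \<open>g\<close> and \<open>h\<close> act equally,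
  evaluation at \<open>inv h \<otimes> x\<close> puts \<open>g \<otimes> inv h\<close> into the
  kernel.\<close>

lemma finite_Mod_poly_kernel:
  assumes p: "p > 0" and gen: "generate G S = carrier G" and S: "finite S" "S \<subseteq> carrier G"
  shows "finite (carrier (G Mod poly_kernel p d))"
proof -
  let ?r = "\<lambda>f. restrict (\<lambda>x. f x mod p) (carrier G)"
  let ?N = "poly_kernel p d"
  let ?Q = "?r ` poly_fun G p d"
  interpret N: normal ?N G by (rule normal_poly_kernel)
  let ?act = "\<lambda>g. \<lambda>f\<in>?Q. ?r (\<lambda>x. f (g \<otimes> x))"
  have r: "?r (\<lambda>x. ?r f (g \<otimes> x)) = ?r (\<lambda>x. f (g \<otimes> x))" if "g \<in> carrier G" for f g
    using that by (auto simp: fun_eq_iff restrict_def)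
  have "?act g \<in> ?Q \<rightarrow>\<^sub>E ?Q" if g: "g \<in> carrier G" for g
    using r[OF g] poly_fun_translate[OF _ g] by (auto simp: PiE_iff)
  then have "?act ` carrier G \<subseteq> ?Q \<rightarrow>\<^sub>E ?Q" by blast
  then have fin: "finite (?act ` carrier G)"
    by (rule finite_subset) (intro finite_PiE finite_poly_fun_reductions[OF p gen S])
  have eq: "?N #> g = ?N #> h"
    if g: "g \<in> carrier G" and h: "h \<in> carrier G" and act: "?act g = ?act h" for g h
  proof -
    have "g \<otimes> inv h \<in> ?N"
    proof (rule poly_kernelI)
      fix f x assume f: "f \<in> poly_fun G p d" and x: "x \<in> carrier G"
      have "?act g (?r f) = ?act h (?r f)" using act by simp
      then have "?r (\<lambda>x. f (g \<otimes> x)) = ?r (\<lambda>x. f (h \<otimes> x))"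
        using f r[OF g] r[OF h] by simp
      from fun_cong[OF this, of "inv h \<otimes> x"] show "[f (g \<otimes> inv h \<otimes> x) = f x] (mod p)"
        using g h x by (simp add: cong_def m_assoc) (simp add: m_assoc[symmetric])
    qed (use g h in simp)
    then have "?N #> (g \<otimes> inv h) = ?N" 
      using g h by (intro coset_join2 N.subgroup_axioms) auto
    then have "?N #> (g \<otimes> inv h) #> h = ?N #> h" by simp
    then show ?thesis
      using g h N.subset by (simp add: coset_mult_assoc m_assoc)
  qed
  from fin show ?thesis
    unfolding carrier_FactGroup by (rule finite_image_factor) (rule eq)
qed

end

section \<open>The quotient is a finite \<open>p\<close>-group and nilpotent\<close>

text \<open>If a prime \<open>q\<close> other than \<open>p\<close> divided the order, Sylow's
  theorem would give a subgroup of order \<open>q\<close>, hence a nontrivial element whose order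
  divides both \<open>q\<close> and \<open>p ^ m\<close>.\<close>

lemma finite_p_groupI:
  assumes K: "group K" "finite (carrier K)" and p: "prime p"
    and pow: "\<And>x. x \<in> carrier K \<Longrightarrow> x [^]\<^bsub>K\<^esub> (p ^ m) = \<one>\<^bsub>K\<^esub>"
  shows "finite_p_group p K"
proof -
  interpret K: group K by fact
  have "Coset.order K \<noteq> 0" using K.order_gt_0_iff_finite K by simp
  then obtain r where r: "Coset.order K = p ^ multiplicity p (Coset.order K) * r" "\<not> p dvd r"
    using multiplicity_decompose'[of "Coset.order K" p] p by (metis not_prime_unit)
  have "r = 1"
  proof (rule ccontr)
    assume "r \<noteq> 1"
    then obtain q where q: "prime q" "q dvd r" using prime_factor_nat by blast
    then have "q \<noteq> p" using r by auto
    obtain u where "Coset.order K = q ^ 1 * u" using q r by (metis dvdE dvd_mult power_one_right)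
    then obtain H where H: "subgroup H K" "card H = q"
      using sylow_thm[OF q(1) K(1) _ K(2)] by (metis power_one_right)
    have "card H > card {\<one>\<^bsub>K\<^esub>}" using H q(1) by (simp add: prime_gt_Suc_0_nat)
    then have "\<not> H \<subseteq> {\<one>\<^bsub>K\<^esub>}" by (meson card_mono finite.intros leD)
    then obtain x where x: "x \<in> H" "x \<noteq> \<one>\<^bsub>K\<^esub>" by auto
    then have xc: "x \<in> carrier K" using subgroup.subset[OF H(1)] by auto
    interpret H: group "K\<lparr>carrier := H\<rparr>" using subgroup.subgroup_is_group[OF H(1) K(1)] .
    have "x [^]\<^bsub>K\<lparr>carrier := H\<rparr>\<^esub> q = \<one>\<^bsub>K\<lparr>carrier := H\<rparr>\<^esub>"
      using H.pow_order_eq_1[of x] x H(2) by (simp add: Coset.order_def)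
    then have "x [^]\<^bsub>K\<^esub> q = \<one>\<^bsub>K\<^esub>" by (simp add: nat_pow_def)
    then have "K.ord x dvd q" "K.ord x dvd p ^ m"
      using pow[OF xc] xc by (simp_all add: K.pow_eq_id)
    moreover have "coprime q (p ^ m)"
      using primes_coprime[OF q(1) p \<open>q \<noteq> p\<close>] by simp
    ultimately have "K.ord x = 1" using coprime_common_divisor_nat by blast
    then show False using K.ord_eq_1[OF xc] x(2) by simp
  qed
  with r K show ?thesis by (auto simp: finite_p_group_def)
qed

text \<open>Surjectivity lets every generating commutator of \<open>K\<close> be lifted to
  \<open>G\<close>, so the inclusion of \<open>hom_lower_central\<close> becomes an
  equality.\<close>

lemma lower_central_surj:
  assumes "group G" "group K" "h \<in> hom G K" "h ` carrier G = carrier K"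
  shows "lower_central K k = h ` lower_central G k"
proof (induction k)
  case (Suc k)
  interpret h: group_hom G K h using assms by (simp add: group_hom_def group_hom_axioms_def)
  let ?c = "\<lambda>G k. \<Union>h \<in> lower_central G k. \<Union>g \<in> carrier G.
    {h \<otimes>\<^bsub>G\<^esub> g \<otimes>\<^bsub>G\<^esub> inv\<^bsub>G\<^esub> h \<otimes>\<^bsub>G\<^esub> inv\<^bsub>G\<^esub> g}"
  note sub = lower_central_subset[OF assms(1), of k, THEN subsetD]
  have c: "?c G k \<subseteq> carrier G" by (auto dest!: sub)
  have "h ` ?c G k = (\<Union>a \<in> lower_central G k. \<Union>g \<in> carrier G.
    {h a \<otimes>\<^bsub>K\<^esub> h g \<otimes>\<^bsub>K\<^esub> inv\<^bsub>K\<^esub> h a \<otimes>\<^bsub>K\<^esub> inv\<^bsub>K\<^esub> h g})"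
    by (simp add: image_UN sub)
  also have "\<dots> = ?c K k"
    by (simp add: Suc assms(4)[symmetric])
  finally show ?case
    unfolding lower_central.simps using h.generate_img[OF c] by simp
qed (use assms in simp)

context group
begin

text \<open>With \<open>D_g\<close> for left differences and
  \<open>y = inv (g \<otimes> h) \<otimes> x\<close>, the difference of \<open>f\<close> at
  \<open>x\<close> along the commutator of \<open>h\<close> and \<open>g\<close> equals
  \<open>D_g (D_h f) y - D_h (D_g f) y\<close>. By induction \<open>D_h\<close> lowers the degree by
  \<open>k + 1\<close>, and \<open>D_g\<close> lowers it by one more.\<close>

lemma lower_central_poly_fun:
  "g \<in> lower_central G k \<Longrightarrow> f \<in> poly_fun G p (Suc k + d) \<Longrightarrow> diff_along ((\<otimes>) g) f \<in> poly_fun G p d"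
proof (induction k arbitrary: g d f)
  case (Suc k)
  note lc = lower_central_subset[OF is_group, of k, THEN subsetD]
  have "h \<otimes> g \<otimes> inv h \<otimes> inv g \<in> {c \<in> carrier G. diff_along ((\<otimes>) c) f \<in> poly_fun G p d}"
    if h: "h \<in> lower_central G k" and g: "g \<in> carrier G" for h g
  proof -
    note hc = lc[OF h]
    let ?D = "\<lambda>a f. diff_along ((\<otimes>) a) f"
    have "?D h f \<in> poly_fun G p (Suc d)"
      using Suc.IH[OF h, of f "Suc d"] Suc.prems(2) by simp
    then have 1: "?D g (?D h f) \<in> poly_fun G p d" using g by simp
    have "?D g f \<in> poly_fun G p (Suc k + d)"
      using Suc.prems(2) g by simp
    then have 2: "?D h (?D g f) \<in> poly_fun G p d" by (rule Suc.IH[OF h])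
    have "(\<lambda>x. (\<lambda>y. ?D g (?D h f) y - ?D h (?D g f) y) (inv (g \<otimes> h) \<otimes> x)) \<in> poly_fun G p d"
      using g hc by (intro poly_fun_translate poly_fun_diff 1 2) simp
    then have "?D (h \<otimes> g \<otimes> inv h \<otimes> inv g) f \<in> poly_fun G p d"
    proof (rule poly_fun_cong)
      fix x assume x: "x \<in> carrier G"
      define y where "y = inv (g \<otimes> h) \<otimes> x"
      have y: "y \<in> carrier G" using g hc x by (simp add: y_def)
      have "g \<otimes> (h \<otimes> y) = x"
        using g hc x by (simp add: y_def m_assoc[symmetric])
      moreover have "h \<otimes> g \<otimes> inv h \<otimes> inv g \<otimes> x = h \<otimes> (g \<otimes> y)"
        using g hc x by (simp add: y_def m_assoc inv_mult_group)
      ultimately show "?D g (?D h f) y - ?D h (?D g f) y = ?D (h \<otimes> g \<otimes> inv h \<otimes> inv g) f x"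
        by (simp add: diff_along_def)
    qed
    then show ?thesis using g hc by simp
  qed
  then have "(\<Union>h \<in> lower_central G k. \<Union>g \<in> carrier G. {h \<otimes> g \<otimes> inv h \<otimes> inv g})
      \<subseteq> {c \<in> carrier G. diff_along ((\<otimes>) c) f \<in> poly_fun G p d}"
    by (intro UN_least) simp
  then have "lower_central G (Suc k) \<subseteq> {c \<in> carrier G. diff_along ((\<otimes>) c) f \<in> poly_fun G p d}"
    unfolding lower_central.simps by (rule generate_subgroup_incl[OF _ subgroup_poly_fun_diff])
  then show ?case using Suc.prems(1) by blast
qed simp

text \<open>The target is the quotient by \<open>poly_kernel\<close>. It has exponent dividing
  \<open>p ^ d\<close> because \<open>d \<le> p ^ d\<close>, and it is nilpotent because
  \<open>lower_central G d\<close> acts trivially. The separating function \<open>f\<close> keeps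
  \<open>g\<close> out of the kernel.\<close>

lemma residual_targets:
  fixes p :: nat
  assumes p: "prime p" and gen: "generate G S = carrier G" and S: "finite S" "S \<subseteq> carrier G"
    and f: "f \<in> poly_fun G (int p) d" and g: "g \<in> carrier G" and sep: "[f g \<noteq> f \<one>] (mod int p)"
  shows "\<exists>(K :: 'a set monoid) h. nilpotent_group K \<and> finite_p_group p K \<and> h \<in> hom G K \<and> h g \<noteq> \<one>\<^bsub>K\<^esub>"
proof -
  let ?N = "poly_kernel (int p) d"
  let ?K = "G Mod ?N"
  let ?h = "\<lambda>a. ?N #> a"
  interpret N: normal ?N G by (rule normal_poly_kernel)
  have K: "group ?K" by (rule N.factorgroup_is_group)
  have h: "?h \<in> hom G ?K" by (rule N.r_coset_hom_Mod)
  have surj: "?h ` carrier G = carrier ?K" by (simp add: carrier_FactGroup)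
  have one: "?h a = \<one>\<^bsub>?K\<^esub>" if "a \<in> ?N" for a
    using that N.subset by (simp add: coset_join2 N.subgroup_axioms subsetD)
  have "p > 1" using p by (rule prime_gt_1_nat)
  then have "d \<le> p ^ d" by (simp add: less_imp_le)
  then have pow: "a [^] (p ^ d) \<in> ?N" if "a \<in> carrier G" for a
    using that by (intro poly_kernelI poly_fun_pow[OF p]) auto
  have "x [^]\<^bsub>?K\<^esub> (p ^ d) = \<one>\<^bsub>?K\<^esub>" if "x \<in> carrier ?K" for x
  proof -
    from that obtain a where a: "x = ?h a" "a \<in> carrier G"
      unfolding surj[symmetric] by (rule imageE)
    show ?thesis
      unfolding a(1) N.FactGroup_pow[OF a(2)] by (rule one[OF pow[OF a(2)]])
  qed
  then have "finite_p_group p ?K"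
    using \<open>p > 1\<close> by (intro finite_p_groupI[OF K _ p] finite_Mod_poly_kernel[OF _ gen S]) auto
  moreover have "nilpotent_group ?K"
  proof -
    have "lower_central G d \<subseteq> ?N"
    proof
      fix a assume a: "a \<in> lower_central G d"
      have ac: "a \<in> carrier G" using a lower_central_subset[OF is_group] by blast
      show "a \<in> ?N"
      proof (rule poly_kernelI[OF ac])
        fix f x assume f: "f \<in> poly_fun G (int p) d" and x: "x \<in> carrier G"
        have "diff_along ((\<otimes>) a) f \<in> poly_fun G (int p) 0"
          using lower_central_poly_fun[OF a, of f "int p" 0] poly_fun_Suc[OF f] by simp
        then show "[f (a \<otimes> x) = f x] (mod int p)"
          using x by (simp add: diff_along_def cong_iff_dvd_diff)
      qed
    qed
    then have "lower_central ?K d \<subseteq> {\<one>\<^bsub>?K\<^esub>}"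
      unfolding lower_central_surj[OF is_group K h surj] using one by blast
    then show ?thesis
      using K one_lower_central[OF K, of d] unfolding nilpotent_group_def by blast
  qed
  moreover have "?h g \<noteq> \<one>\<^bsub>?K\<^esub>"
  proof
    assume "?h g = \<one>\<^bsub>?K\<^esub>"
    then have "g \<in> ?N" using rcos_self[OF g N.subgroup_axioms] by simp
    from poly_kernelD[OF this f one_closed] g sep show False by simp
  qed
  ultimately show ?thesis using h by (intro exI[of _ ?K] exI[of _ ?h] conjI)
qed

end

section \<open>Coefficients of the Magnus expansion\<close>

text \<open>\<open>magnus w u\<close> is the coefficient of the monomial \<open>u\<close> in the image of \<open>w\<close> under
  \<open>x\<^sub>i \<mapsto> 1 + X\<^sub>i\<close>. For an inverse letter the last equation expresses that \<open>y = (1 + X\<^sub>i)\<^sup>-\<^sup>1 z\<close> satisfies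
  \<open>y = z - X\<^sub>i y\<close>.\<close>

fun magnus :: "letter list \<Rightarrow> nat list \<Rightarrow> int" where
  "magnus [] u = (if u = [] then 1 else 0)"
| "magnus (a # w) [] = magnus w []"
| "magnus (a # w) (j # u) = magnus w (j # u) +
     (if j = fst a then (if snd a then magnus w u else - magnus (a # w) u) else 0)"

lemma magnus_empty [simp]: "magnus w [] = 1"
  by (induction w) auto

text \<open>Left multiplication by a generator is multiplication of the series by
  \<open>1 + X_i\<close>. When \<open>push\<close> cancels an inverse letter, this is the defining
  equation of that letter's coefficients.\<close>

lemma magnus_push_gen:
  "magnus (push (i, True) w) u
     = magnus w u + (case u of [] \<Rightarrow> 0 | j # u' \<Rightarrow> if j = i then magnus w u' else 0)"
proof (cases w)
  case (Cons b w')
  show ?thesis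
  proof (cases "b = inv_letter (i, True)")
    case True
    then show ?thesis using Cons by (auto simp: inv_letter_def split: list.split)
  qed (use Cons in \<open>auto split: list.split\<close>)
qed (auto split: list.split)

text \<open>The difference along a generator deletes the first variable of the monomial if the
  indices agree, and gives zero otherwise.\<close>

lemma magnus_poly_fun: "(\<lambda>w. magnus w u) \<in> poly_fun (free_group n) p (Suc (length u))"
proof -
  interpret F: group "free_group n" by (rule group_free_group)
  show ?thesis
  proof (induction u)
    case Nil
    show ?case by (simp add: diff_along_def)
  next
    case (Cons j u)
    have "diff_along ((\<otimes>\<^bsub>free_group n\<^esub>) (free_gen i)) (\<lambda>w. magnus w (j # u))
        = (\<lambda>w. (if j = i then 1 else 0) * magnus w u)" for i
      by (simp add: diff_along_def mult_free_group free_gen_def magnus_push_gen fun_eq_iff)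
    then have "diff_along ((\<otimes>\<^bsub>free_group n\<^esub>) (free_gen i)) (\<lambda>w. magnus w (j # u))
        \<in> poly_fun (free_group n) p (Suc (length u))" for i
      by (simp only: poly_fun_cmult[OF Cons])
    then show ?case
      unfolding list.size(4) add_Suc_right add_0_right
      by (intro F.poly_fun_generators[OF generate_free_group]) (blast intro: free_gen_closed)
  qed
qed

section \<open>Nonvanishing Magnus coefficients\<close>

text \<open>The number of maximal blocks of equal entries.\<close>

abbreviation syllables :: "nat list \<Rightarrow> nat" where
  "syllables v \<equiv> length (remdups_adj v)"

lemma syllables_Cons: "syllables (i # v) = (if v \<noteq> [] \<and> hd v = i then syllables v else Suc (syllables v))"
  by (cases v) auto

text \<open>A block of letters with one index contributes a power series in a single variable. A
  monomial therefore cannot have more blocks than the word, and with equally many it must start with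
  the word's first index.\<close>

lemma magnus_eq_0:
  assumes "syllables (map fst w) < syllables u \<or>
    syllables (map fst w) = syllables u \<and> u \<noteq> [] \<and> hd u \<noteq> fst (hd w)"
  shows "magnus w u = 0"
  using assms
proof (induction w u rule: magnus.induct)
  case (3 a w j u)
  let ?s = "syllables (map fst w)"
  have hd_map: "w \<noteq> [] \<Longrightarrow> hd (map fst w) = fst (hd w)" by (cases w) auto
  have z: "syllables v = 0 \<longleftrightarrow> v = []" for v :: "nat list" by simp
  have "magnus w (j # u) = 0"
    using 3(1,4) hd_map by (auto simp: syllables_Cons[of "fst a"] split: if_splits simp del: remdups_adj.simps)
  moreover have "magnus w u = 0" if "j = fst a" "snd a"
    using 3(2)[OF that] 3(4) that hd_map z[of "map fst w"] z[of u]
    by (auto simp: syllables_Cons less_Suc_eq split: if_splits simp del: remdups_adj.simps(2,3) length_0_conv)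
  moreover have "magnus (a # w) u = 0" if "j = fst a" "\<not> snd a"
    using 3(3)[OF that] 3(4) that hd_map z[of "map fst w"] z[of u]
    by (auto simp: syllables_Cons less_Suc_eq split: if_splits simp del: remdups_adj.simps(2,3) length_0_conv)
  ultimately show ?case by simp
qed auto

text \<open>Each row is the preceding one multiplied by \<open>1 + X\<close>, and row 0 is constant
  modulo \<open>p\<close>; hence row \<open>j\<close> is that constant times
  \<open>(1 + X)^j\<close>.\<close>

lemma pascal_cong:
  fixes F :: "nat \<Rightarrow> nat \<Rightarrow> int"
  assumes F0: "\<And>s. [F 0 (Suc s) = 0] (mod p)"
    and F: "\<And>j. j < k \<Longrightarrow> F (Suc j) 0 = F j 0"
      "\<And>j s. j < k \<Longrightarrow> F (Suc j) (Suc s) = F j (Suc s) + F j s"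
  shows "j \<le> k \<Longrightarrow> [F j s = int (j choose s) * F 0 0] (mod p)"
proof (induction j arbitrary: s)
  case 0
  then show ?case using F0 by (cases s) auto
next
  case (Suc j)
  show ?case
  proof (cases s)
    case 0
    then show ?thesis using Suc F(1)[of j] by (metis Suc_leD Suc_le_lessD binomial_n_0)
  next
    case (Suc t)
    then show ?thesis
      using F(2)[of j t] cong_add[OF Suc.IH[of "Suc t"] Suc.IH[of t]] Suc.prems
      by (simp add: algebra_simps)
  qed
qed

text \<open>In a reduced word a neighbour of \<open>a\<close> with the same index is
  \<open>a\<close> itself, since \<open>inv_letter a\<close> is excluded. So the first syllable is a
  power of one letter.\<close>

lemma reduced_block:
  assumes "reduced (a # w)"
  obtains k w' where "a # w = replicate (Suc k) a @ w'" "reduced w'" "w' \<noteq> [] \<Longrightarrow> fst (hd w') \<noteq> fst a"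
  using assms
proof (induction w arbitrary: thesis)
  case Nil
  then show ?case using Nil(1)[of 0 "[]"] by simp
next
  case (Cons b w)
  show ?case
  proof (cases "b = a")
    case True
    then obtain k w' where kw: "a # w = replicate (Suc k) a @ w'" "reduced w'"
        "w' \<noteq> [] \<Longrightarrow> fst (hd w') \<noteq> fst a"
      using Cons by auto
    then show ?thesis using Cons.prems(1)[of "Suc k" w'] True by simp
  next
    case False
    then have "fst b \<noteq> fst a"
      using Cons.prems(2) by (auto simp: inv_letter_def prod_eq_iff)
    then show ?thesis using Cons.prems(1)[of 0 "b # w"] Cons.prems(2) by (auto dest: reduced_tl)
  qed
qed

text \<open>Induction by removal of the first syllable, prefixing a block of its variable to the
  monomial found for the rest. The block count in the statement makes the coefficients
  \<open>f 0 (Suc s)\<close> vanish, and the condition on the first index keeps the new block from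
  merging with \<open>u'\<close>.\<close>

lemma magnus_not_dvd:
  assumes p: "prime (p::nat)" and w: "reduced w"
  shows "\<exists>u. syllables u = syllables (map fst w) \<and> (u \<noteq> [] \<longrightarrow> hd u = fst (hd w)) \<and>
           \<not> int p dvd magnus w u"
  using w
proof (induction "length w" arbitrary: w rule: less_induct)
  case less
  show ?case
  proof (cases w)
    case Nil
    then show ?thesis using p by (intro exI[of _ "[]"]) auto
  next
    case (Cons a v)
    obtain k w' where w: "w = replicate (Suc k) a @ w'" and w': "reduced w'"
        "w' \<noteq> [] \<Longrightarrow> fst (hd w') \<noteq> fst a"
      using reduced_block[of a v] less.prems Cons by metis
    obtain u' where u': "syllables u' = syllables (map fst w')"
        "u' \<noteq> [] \<longrightarrow> hd u' = fst (hd w')" "\<not> int p dvd magnus w' u'"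
      using less.hyps[of w'] w w'(1) by auto
    have ne: "u' = [] \<or> hd u' \<noteq> fst a"
      using u'(1,2) w'(2) by (metis length_0_conv remdups_adj_Nil_iff map_is_Nil_conv)
    have syl: "syllables (replicate (Suc s) (fst a) @ v) = Suc (syllables v)"
      if "v = [] \<or> hd v \<noteq> fst a" for s v
      by (induction s) (use that in \<open>auto simp: syllables_Cons simp del: remdups_adj.simps\<close>)
    \<comment> \<open>The row \<open>f (Suc k)\<close> is \<open>(1 + X)\<close> to the power \<open>\<plusminus>(k + 1)\<close> times the constant row \<open>f 0\<close>. If it were
      constant modulo \<open>p\<close> as well, then the coefficient of \<open>X\<close> to the power \<open>k + 1\<close> in
      \<open>(1 + X)\<close> to the power \<open>k + 1\<close>, which is 1, would vanish.\<close>
    define f where "f j s = magnus (replicate j a @ w') (replicate s (fst a) @ u')" for j s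
    have f0: "f 0 (Suc s) = 0" for s
      unfolding f_def using syl[OF ne, of s] u'(1) by (intro magnus_eq_0) simp
    have f1: "f (Suc j) 0 = f j 0" for j
      using ne by (cases u') (auto simp: f_def)
    have f2: "f (Suc j) (Suc s) = f j (Suc s) + (if snd a then f j s else - f (Suc j) s)" for j s
      by (simp add: f_def)
    have f3: "f j 0 = f 0 0" for j by (induction j) (simp_all add: f1)
    have nz: "\<not> int p dvd f 0 0" using u'(3) by (simp add: f_def)
    have "\<exists>s. \<not> int p dvd f (Suc k) (Suc s)"
    proof (rule ccontr)
      assume *: "\<nexists>s. \<not> int p dvd f (Suc k) (Suc s)"
      show False
      proof (cases "snd a")
        case True
        have "[f (Suc k) (Suc k) = int (Suc k choose Suc k) * f 0 0] (mod int p)"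
          by (rule pascal_cong[where k = "Suc k"]) (use True f0 f1 f2 in auto)
        then show False
          using cong_dvd_iff[of "f (Suc k) (Suc k)" "f 0 0" "int p"] * nz by simp
      next
        case False
        \<comment> \<open>For an inverse letter, row \<open>j\<close> is \<open>1 + X\<close> times
          row \<open>Suc j\<close>. The rows are therefore read backwards, from row
          \<open>Suc k\<close>, constant by assumption, to row 0.\<close>
        have "[f (Suc k - Suc k) (Suc k) = int (Suc k choose Suc k) * f (Suc k - 0) 0] (mod int p)"
        proof (rule pascal_cong[where k = "Suc k" and F = "\<lambda>j. f (Suc k - j)"])
          fix j s assume "j < Suc k"
          then have "Suc k - j = Suc (Suc k - Suc j)" by simp
          then show "f (Suc k - Suc j) 0 = f (Suc k - j) 0"
            "f (Suc k - Suc j) (Suc s) = f (Suc k - j) (Suc s) + f (Suc k - j) s"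
            using False f1 f2[of "Suc k - Suc j" s] by simp_all
        qed (use * in \<open>auto simp: cong_0_iff\<close>)
        then show False using nz f0[of k] f3[of "Suc k"] by (simp add: cong_dvd_iff cong_0_iff cong_sym_eq[of 0])
      qed
    qed
    then obtain s where s: "\<not> int p dvd magnus w (replicate (Suc s) (fst a) @ u')"
      by (auto simp: f_def w)
    have "w' = [] \<or> hd (map fst w') \<noteq> fst a" using w'(2) by (cases w') auto
    then have "syllables (map fst w) = Suc (syllables (map fst w'))"
      using syl[of "map fst w'" k] by (simp add: w map_replicate_const)
    with s syl[OF ne, of s] u'(1) show ?thesis
      by (intro exI[of _ "replicate (Suc s) (fst a) @ u'"]) (simp add: w)
  qed
qed

lemma free_group_separating:
  assumes p: "prime (p::nat)" and w: "w \<in> carrier (free_group n)" "w \<noteq> \<one>\<^bsub>free_group n\<^esub>"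
  shows "\<exists>d. \<exists>f\<in>poly_fun (free_group n) (int p) d. [f w \<noteq> f \<one>\<^bsub>free_group n\<^esub>] (mod int p)"
proof -
  obtain u where u: "syllables u = syllables (map fst w)" "\<not> int p dvd magnus w u"
    using magnus_not_dvd[OF p, of w] w(1) by (auto simp: carrier_free_group)
  moreover have "u \<noteq> []" using u(1) w(2) by (auto simp: one_free_group)
  ultimately have "[magnus w u \<noteq> magnus \<one>\<^bsub>free_group n\<^esub> u] (mod int p)"
    by (simp add: one_free_group cong_0_iff)
  then show ?thesis
    using magnus_poly_fun[of u n "int p"] by (intro exI[of _ "Suc (length u)"] bexI[of _ "\<lambda>w. magnus w u"])
qed

section \<open>Automorphisms that are trivial on the homology modulo p\<close>

text \<open>Since \<open>D_(vw) f = D_v f + D_w f + D_w (D_v f)\<close> for left differences,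
  \<open>D_w f\<close> is additive in \<open>w\<close> up to functions two levels lower. Hence at
  this precision it depends only on the exponent sums of \<open>w\<close>.\<close>

lemma diff_along_exp_sum:
  assumes w: "w \<in> carrier (free_group n)" and f: "f \<in> poly_fun (free_group n) p (Suc (Suc d))"
  shows "(\<lambda>x. diff_along ((\<otimes>\<^bsub>free_group n\<^esub>) w) f x
      - (\<Sum>i<n. exp_sum i w * diff_along ((\<otimes>\<^bsub>free_group n\<^esub>) (free_gen i)) f x))
    \<in> poly_fun (free_group n) p d"
proof -
  interpret F: group "free_group n" by (rule group_free_group)
  have e: "group_hom (free_group n) integer_group (exp_sum i)" for i
    by (simp add: group_hom_def group_hom_axioms_def exp_sum_hom)
  let ?D = "\<lambda>w f. diff_along ((\<otimes>\<^bsub>free_group n\<^esub>) w) f"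
  have DD: "?D v (?D w f) \<in> poly_fun (free_group n) p d"
    if "v \<in> carrier (free_group n)" "w \<in> carrier (free_group n)" for v w
    using f that by simp
  have gens: "free_gen ` {..<n} \<subseteq> carrier (free_group n)" by (auto intro: free_gen_closed)
  show ?thesis
    using w unfolding generate_free_group[symmetric]
  proof (induction w rule: generate.induct)
    case one
    show ?case
      by (rule F.poly_fun_cong[OF zero_poly_fun])
         (simp add: diff_along_def group_hom.hom_one[OF e])
  next
    case (incl w)
    then obtain j where j: "j < n" "w = free_gen j" by auto
    show ?case
      by (rule F.poly_fun_cong[OF zero_poly_fun])
         (use j in \<open>simp add: exp_sum_free_gen if_distrib[of "\<lambda>c. c * _"] cong: if_cong\<close>)
  next
    case (inv w)
    then obtain j where j: "j < n" "w = free_gen j" by auto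
    have w: "w \<in> carrier (free_group n)" using inv gens by auto
    have "(\<lambda>x. - 1 * ?D (inv\<^bsub>free_group n\<^esub> w) (?D w f) x) \<in> poly_fun (free_group n) p d"
      using w by (intro poly_fun_cmult DD) auto
    then show ?case
    proof (rule F.poly_fun_cong)
      fix x assume x: "x \<in> carrier (free_group n)"
      have "exp_sum i (inv\<^bsub>free_group n\<^esub> w) = (if j = i then - 1 else 0)" for i
        using group_hom.hom_inv[OF e w, of i] j by (simp add: exp_sum_free_gen)
      then have "(\<Sum>i<n. exp_sum i (inv\<^bsub>free_group n\<^esub> w) * ?D (free_gen i) f x) = - ?D w f x"
        using j by (simp add: if_distrib[of "\<lambda>c. c * _"] cong: if_cong)
      moreover have "w \<otimes>\<^bsub>free_group n\<^esub> (inv\<^bsub>free_group n\<^esub> w \<otimes>\<^bsub>free_group n\<^esub> x) = x"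
        using w x by (simp add: F.m_assoc[symmetric])
      ultimately show "- 1 * ?D (inv\<^bsub>free_group n\<^esub> w) (?D w f) x = ?D (inv\<^bsub>free_group n\<^esub> w) f x
          - (\<Sum>i<n. exp_sum i (inv\<^bsub>free_group n\<^esub> w) * ?D (free_gen i) f x)"
        by (simp add: diff_along_def)
    qed
  next
    case (eng v w)
    have vw: "v \<in> carrier (free_group n)" "w \<in> carrier (free_group n)"
      using eng.hyps by (simp_all add: generate_free_group)
    show ?case
    proof (rule F.poly_fun_cong[OF poly_fun_add[OF poly_fun_add[OF eng.IH] DD[OF vw(2,1)]]])
      fix x assume x: "x \<in> carrier (free_group n)"
      have "exp_sum i (v \<otimes>\<^bsub>free_group n\<^esub> w) = exp_sum i v + exp_sum i w" for i
        using group_hom.hom_mult[OF e vw, of i] by simp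
      then show "?D v f x - (\<Sum>i<n. exp_sum i v * ?D (free_gen i) f x)
            + (?D w f x - (\<Sum>i<n. exp_sum i w * ?D (free_gen i) f x)) + ?D w (?D v f) x
          = ?D (v \<otimes>\<^bsub>free_group n\<^esub> w) f x
            - (\<Sum>i<n. exp_sum i (v \<otimes>\<^bsub>free_group n\<^esub> w) * ?D (free_gen i) f x)"
        using x vw by (simp add: distrib_right sum.distrib) (simp add: diff_along_def F.m_assoc)
    qed
  qed
qed

text \<open>For a generator \<open>x\<close>, \<open>D_x (diff_along s f) = diff_along s (D_(s x) f)
  + (D_(s x) f - D_x f)\<close>. The first summand is handled by induction, the second by
  \<open>diff_along_exp_sum\<close>, as \<open>x\<close> and \<open>s x\<close> have congruent
  exponent sums.\<close>

lemma poly_fun_ab_trivial: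
  assumes s: "s \<in> hom (free_group n) (free_group n)"
    and tr: "\<And>i j. i < n \<Longrightarrow> j < n \<Longrightarrow> [exp_sum i (s (free_gen j)) = exp_sum i (free_gen j)] (mod p)"
  shows "f \<in> poly_fun (free_group n) p (Suc d) \<Longrightarrow> diff_along s f \<in> poly_fun (free_group n) p d"
proof (induction d arbitrary: f)
  case 0
  interpret F: group "free_group n" by (rule group_free_group)
  have c: "p dvd f x - f \<one>\<^bsub>free_group n\<^esub>" if "x \<in> carrier (free_group n)" for x
  proof -
    have "diff_along ((\<otimes>\<^bsub>free_group n\<^esub>) x) f \<in> poly_fun (free_group n) p 0"
      using 0 that unfolding poly_fun.simps(2) by blast
    then show ?thesis using that by (auto simp: diff_along_def dest!: bspec[of _ _ "\<one>\<^bsub>free_group n\<^esub>"])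
  qed
  have "p dvd (f (s x) - f \<one>\<^bsub>free_group n\<^esub>) - (f x - f \<one>\<^bsub>free_group n\<^esub>)"
    if "x \<in> carrier (free_group n)" for x
    using that s by (intro dvd_diff c) (auto simp: hom_in_carrier)
  then show ?case by (simp add: diff_along_def)
next
  case (Suc d)
  interpret F: group "free_group n" by (rule group_free_group)
  let ?D = "\<lambda>w f. diff_along ((\<otimes>\<^bsub>free_group n\<^esub>) w) f"
  have "?D (free_gen j) (diff_along s f) \<in> poly_fun (free_group n) p d" if j: "j < n" for j
  proof -
    let ?x = "free_gen j"
    have xc: "?x \<in> carrier (free_group n)" "s ?x \<in> carrier (free_group n)"
      using j s by (auto simp: free_gen_closed hom_in_carrier)
    have 1: "diff_along s (?D (s ?x) f) \<in> poly_fun (free_group n) p d"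
      using Suc xc by simp
    have "(\<lambda>y. ?D (s ?x) f y - (\<Sum>i<n. exp_sum i (s ?x) * ?D (free_gen i) f y)) \<in> poly_fun (free_group n) p d"
      using xc Suc.prems by (intro diff_along_exp_sum)
    then have 2: "(\<lambda>y. ?D (s ?x) f y - ?D ?x f y) \<in> poly_fun (free_group n) p d"
    proof (rule F.poly_fun_cong_mod)
      fix y assume "y \<in> carrier (free_group n)"
      have "[(\<Sum>i<n. exp_sum i (s ?x) * ?D (free_gen i) f y)
          = (\<Sum>i<n. exp_sum i ?x * ?D (free_gen i) f y)] (mod p)"
        by (intro cong_sum cong_mult tr j cong_refl) auto
      also have "(\<Sum>i<n. exp_sum i ?x * ?D (free_gen i) f y) = ?D ?x f y"
        using j by (simp add: exp_sum_free_gen if_distrib[of "\<lambda>c. c * _"] cong: if_cong)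
      finally show "[?D (s ?x) f y - (\<Sum>i<n. exp_sum i (s ?x) * ?D (free_gen i) f y)
          = ?D (s ?x) f y - ?D ?x f y] (mod p)"
        by (intro cong_diff cong_refl)
    qed
    show ?thesis
      by (rule F.poly_fun_cong[OF poly_fun_add[OF 1 2]])
         (use s xc in \<open>simp add: diff_along_def hom_mult\<close>)
  qed
  then show ?case
    by (intro F.poly_fun_generators[OF generate_free_group]) (auto intro: free_gen_closed)
qed

section \<open>Extending polynomial functions to the mapping torus\<close>

text \<open>Modulo \<open>p\<close>, the \<open>q\<close>-fold difference along \<phi> is the
  difference along \<open>\<phi> ^^ q\<close>, which lowers the degree on \<open>N\<close> by
  assumption. Thus one degree on \<open>N\<close> costs at most \<open>q\<close> degrees on the
  semidirect product.\<close>

lemma poly_fun_fst_semidirect_int: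
  fixes p :: nat
  assumes N: "group N" and \<phi>: "\<phi> \<in> auto N" and p: "prime p" and q: "q = p ^ m"
    and tr: "\<And>d f. f \<in> poly_fun N (int p) (Suc d) \<Longrightarrow> diff_along (\<phi> ^^ q) f \<in> poly_fun N (int p) d"
  shows "f \<in> poly_fun N (int p) d \<Longrightarrow> (\<lambda>x. f (fst x)) \<in> poly_fun (semidirect_int N \<phi>) (int p) (d * q)"
proof -
  let ?G = "semidirect_int N \<phi>"
  interpret N: group N by (rule N)
  interpret G: group ?G by (rule group_semidirect_int[OF N \<phi>])
  have \<phi>h: "\<phi> \<in> hom N N" using \<phi> by (simp add: auto_def)
  note carr = carrier_semidirect_int[OF N \<phi>] and mult = mult_semidirect_int[OF N \<phi>]
  \<comment> \<open>Left translation by \<open>t\<^sup>-\<^sup>1 = (\<one>, -1)\<close>, and not by \<open>t\<close>, acts on the first component through \<open>\<phi>\<close>.\<close>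
  have crit: "(\<lambda>x. f (fst x)) \<in> poly_fun ?G (int p) (Suc e)"
    if t: "(\<lambda>x. diff_along \<phi> f (fst x)) \<in> poly_fun ?G (int p) e"
      and a: "\<And>a. a \<in> carrier N \<Longrightarrow>
        (\<lambda>x. diff_along ((\<otimes>\<^bsub>N\<^esub>) a) f (fst x)) \<in> poly_fun ?G (int p) e" for f e
  proof -
    let ?H = "{g \<in> carrier ?G. diff_along ((\<otimes>\<^bsub>?G\<^esub>) g) (\<lambda>x. f (fst x)) \<in> poly_fun ?G (int p) e}"
    have H: "subgroup ?H ?G" by (rule G.subgroup_poly_fun_diff)
    have t_carr: "(\<one>\<^bsub>N\<^esub>, 1) \<in> carrier ?G" by (simp add: carr)
    have "diff_along ((\<otimes>\<^bsub>?G\<^esub>) (\<one>\<^bsub>N\<^esub>, - 1)) (\<lambda>x. f (fst x)) \<in> poly_fun ?G (int p) e"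
    proof (rule G.poly_fun_cong[OF t])
      fix x assume "x \<in> carrier ?G"
      then obtain b i where x: "x = (b, i)" "b \<in> carrier N" by (auto simp: carr)
      have "(\<one>\<^bsub>N\<^esub>, - 1) \<otimes>\<^bsub>?G\<^esub> (b, i) = (\<phi> b, i - 1)"
        using auto_closed[OF \<phi> x(2)] by (simp add: mult int_pow_auto_1[OF N \<phi>])
      then show "diff_along \<phi> f (fst x) = diff_along ((\<otimes>\<^bsub>?G\<^esub>) (\<one>\<^bsub>N\<^esub>, - 1)) (\<lambda>x. f (fst x)) x"
        by (simp add: x diff_along_def)
    qed
    then have "inv\<^bsub>?G\<^esub> (\<one>\<^bsub>N\<^esub>, 1) \<in> ?H"
      by (simp add: inv_t_semidirect_int[OF N \<phi>] carr)
    from subgroup.m_inv_closed[OF H this] have "(\<one>\<^bsub>N\<^esub>, 1) \<in> ?H"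
      by (simp only: G.inv_inv[OF t_carr])
    moreover have "(a, 0) \<in> ?H" if ac: "a \<in> carrier N" for a
    proof -
      have "diff_along ((\<otimes>\<^bsub>?G\<^esub>) (a, 0)) (\<lambda>x. f (fst x)) \<in> poly_fun ?G (int p) e"
      proof (rule G.poly_fun_cong[OF a[OF ac]])
        fix x assume "x \<in> carrier ?G"
        then obtain b i where x: "x = (b, i)" "b \<in> carrier N" by (auto simp: carr)
        then have "(a, 0) \<otimes>\<^bsub>?G\<^esub> (b, i) = (a \<otimes>\<^bsub>N\<^esub> b, i)"
          by (simp add: mult int_pow_auto_0[OF N \<phi>] del: int_pow_0)
        then show "diff_along ((\<otimes>\<^bsub>N\<^esub>) a) f (fst x) = diff_along ((\<otimes>\<^bsub>?G\<^esub>) (a, 0)) (\<lambda>x. f (fst x)) x"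
          by (simp add: x diff_along_def)
      qed
      then show ?thesis using ac by (simp add: carr)
    qed
    ultimately have "insert (\<one>\<^bsub>N\<^esub>, 1) ((\<lambda>a. (a, 0)) ` carrier N) \<subseteq> ?H" by blast
    from G.generate_subgroup_incl[OF this H]
    have "carrier ?G \<subseteq> ?H"
      using generate_semidirect_int[OF N \<phi> order_refl] N.generate_incl[OF order_refl]
      by (simp add: subset_antisym generate.incl subsetI)
    then show ?thesis unfolding poly_fun.simps by blast
  qed
  show "f \<in> poly_fun N (int p) d \<Longrightarrow> (\<lambda>x. f (fst x)) \<in> poly_fun ?G (int p) (d * q)"
  proof (induction d arbitrary: f)
    case 0
    then show ?case by (auto simp: carr)
  next
    case (Suc d)
    \<comment> \<open>Here \<open>j\<close> differences along \<phi> bring \<open>f\<close> down to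
      level \<open>d\<close>. Each costs one level on \<open>?G\<close>, whereas a difference along
      an element of \<open>N\<close> reaches level \<open>d\<close> at once.\<close>
    have step: "f \<in> poly_fun N (int p) (Suc d) \<Longrightarrow> (diff_along \<phi> ^^ j) f \<in> poly_fun N (int p) d
        \<Longrightarrow> (\<lambda>x. f (fst x)) \<in> poly_fun ?G (int p) (d * q + j)" for j f
    proof (induction j arbitrary: f)
      case 0
      then show ?case using Suc.IH by simp
    next
      case (Suc j)
      have "diff_along \<phi> f \<in> poly_fun N (int p) (Suc d)"
        using poly_fun_diff[OF N.poly_fun_hom[OF \<phi>h Suc.prems(1)] Suc.prems(1)]
        by (simp only: diff_along_def)
      then have "(\<lambda>x. diff_along \<phi> f (fst x)) \<in> poly_fun ?G (int p) (d * q + j)"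
        using Suc.prems(2) by (intro Suc.IH) (simp_all only: funpow_Suc_right o_apply)
      moreover have "(\<lambda>x. diff_along ((\<otimes>\<^bsub>N\<^esub>) a) f (fst x)) \<in> poly_fun ?G (int p) (d * q + j)"
        if "a \<in> carrier N" for a
      proof (rule G.poly_fun_mono)
        show "(\<lambda>x. diff_along ((\<otimes>\<^bsub>N\<^esub>) a) f (fst x)) \<in> poly_fun ?G (int p) (d * q)"
          using Suc.prems(1) that by (intro \<open>\<And>f. f \<in> poly_fun N (int p) d \<Longrightarrow> _\<close>) simp
      qed simp
      ultimately show ?case unfolding add_Suc_right by (rule crit)
    qed
    have "(diff_along \<phi> ^^ q) f \<in> poly_fun N (int p) d"
    proof (rule N.poly_fun_cong_mod[OF tr[OF Suc.prems]])
      fix x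
      show "[diff_along (\<phi> ^^ q) f x = (diff_along \<phi> ^^ q) f x] (mod int p)"
        using cong_diff[OF diff_along_prime_power[OF p q, where f = f and \<sigma> = \<phi> and x = x] cong_refl[of "f x"]]
        by (simp add: diff_along_def[of "\<phi> ^^ q"])
    qed
    from step[OF Suc.prems this] show ?case by (simp add: add.commute)
  qed
qed

section \<open>Separating the elements of the mapping torus\<close>

lemma hom_funpow: "s \<in> hom G G \<Longrightarrow> (s ^^ k) \<in> hom G G"
  by (induction k) (auto simp: hom_def Pi_iff)

text \<open>A nontrivial free component is detected by an extended polynomial function; otherwise
  the element is a power of \<open>t\<close> and is detected in the infinite cyclic
  quotient.\<close>

lemma free_by_cyclic_targets:
  fixes p :: nat
  assumes \<phi>: "\<phi> \<in> auto (free_group n)" and p: "prime p"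
    and tr: "\<And>i j. i < n \<Longrightarrow> j < n \<Longrightarrow>
      [exp_sum i ((\<phi> ^^ (p ^ m)) (free_gen j)) = exp_sum i (free_gen j)] (mod int p)"
    and g: "g \<in> carrier (semidirect_int (free_group n) \<phi>)" "g \<noteq> \<one>\<^bsub>semidirect_int (free_group n) \<phi>\<^esub>"
  shows "\<exists>(K :: (letter list \<times> int) set monoid) h. nilpotent_group K \<and> finite_p_group p K \<and>
    h \<in> hom (semidirect_int (free_group n) \<phi>) K \<and> h g \<noteq> \<one>\<^bsub>K\<^esub>"
proof -
  let ?F = "free_group n" and ?G = "semidirect_int (free_group n) \<phi>"
  note F = group_free_group
  interpret G: group ?G by (rule group_semidirect_int[OF F \<phi>])
  have one: "\<one>\<^bsub>?G\<^esub> = (\<one>\<^bsub>?F\<^esub>, 0)" by (rule one_semidirect_int[OF F \<phi>])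
  have \<phi>h: "\<phi> \<in> hom ?F ?F" using \<phi> by (simp add: auto_def)
  obtain w k where wk: "g = (w, k)" "w \<in> carrier ?F"
    using g(1) by (auto simp: carrier_semidirect_int[OF F \<phi>])
  have "\<exists>d. \<exists>f\<in>poly_fun ?G (int p) d. [f g \<noteq> f \<one>\<^bsub>?G\<^esub>] (mod int p)"
  proof (cases "w = \<one>\<^bsub>?F\<^esub>")
    case False
    obtain d f where f: "f \<in> poly_fun ?F (int p) d" "[f w \<noteq> f \<one>\<^bsub>?F\<^esub>] (mod int p)"
      using free_group_separating[OF p wk(2) False] by blast
    have "(\<lambda>x. f (fst x)) \<in> poly_fun ?G (int p) (d * p ^ m)"
      by (rule poly_fun_fst_semidirect_int[OF F \<phi> p refl _ f(1)])
         (intro poly_fun_ab_trivial hom_funpow \<phi>h tr)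
    then show ?thesis
      using f(2) by (intro exI[of _ "d * p ^ m"] bexI[of _ "\<lambda>x. f (fst x)"]) (simp_all add: wk one)
  next
    case True
    then have k: "k \<noteq> 0" using g(2) by (simp add: wk one)
    \<comment> \<open>The powers of \<open>t\<close> are separated by the Magnus coefficients of the infinite cyclic group.\<close>
    let ?Z = "free_group (Suc 0)"
    interpret Z: group ?Z by (rule group_free_group)
    interpret e: group_hom ?Z integer_group "exp_sum 0"
      by (intro group_hom.intro group_hom_axioms.intro group_integer_group Z.is_group exp_sum_hom)
    let ?x = "free_gen 0"
    have x: "?x \<in> carrier ?Z" by (simp add: free_gen_closed)
    have h: "(\<lambda>y. ?x [^]\<^bsub>?Z\<^esub> (snd y :: int)) \<in> hom ?G ?Z"
      by (rule homI)
         (auto simp: carrier_semidirect_int[OF F \<phi>] mult_semidirect_int[OF F \<phi>] x Z.int_pow_mult)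
    have "exp_sum 0 (?x [^]\<^bsub>?Z\<^esub> k) = k"
      using e.hom_int_pow[OF x, of k] by (simp add: exp_sum_free_gen)
    then have "?x [^]\<^bsub>?Z\<^esub> k \<noteq> \<one>\<^bsub>?Z\<^esub>" using k e.hom_one by auto
    then obtain d f where f: "f \<in> poly_fun ?Z (int p) d" "[f (?x [^]\<^bsub>?Z\<^esub> k) \<noteq> f \<one>\<^bsub>?Z\<^esub>] (mod int p)"
      using free_group_separating[OF p Z.int_pow_closed[OF x, of k]] by blast
    have "(\<lambda>y. f (?x [^]\<^bsub>?Z\<^esub> (snd y :: int))) \<in> poly_fun ?G (int p) d"
      by (rule G.poly_fun_hom[OF h f(1)])
    then show ?thesis
      using f(2) by (intro exI[of _ d] bexI[of _ "\<lambda>y. f (?x [^]\<^bsub>?Z\<^esub> (snd y :: int))"])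
        (simp_all add: wk one)
  qed
  then obtain d f where f: "f \<in> poly_fun ?G (int p) d" "[f g \<noteq> f \<one>\<^bsub>?G\<^esub>] (mod int p)" by blast
  show ?thesis
    by (rule G.residual_targets[OF p free_by_cyclic_generate[OF \<phi>] _ _ f(1) g(1) f(2)])
       (auto simp: carrier_semidirect_int[OF F \<phi>] free_gen_closed group.is_monoid[OF F])
qed

section \<open>The induced matrix\<close>

text \<open>Both sides are homomorphisms to the integers in \<open>w\<close> and agree on the
  generators.\<close>

lemma exp_sum_hom_image:
  assumes s: "s \<in> hom (free_group n) (free_group n)" and w: "w \<in> carrier (free_group n)"
  shows "exp_sum i (s w) = (\<Sum>k<n. exp_sum i (s (free_gen k)) * exp_sum k w)"
proof (rule free_group_hom_eq[OF group_integer_group _ _ _ w,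
      where f = "\<lambda>w. exp_sum i (s w)" and g = "\<lambda>w. \<Sum>k<n. exp_sum i (s (free_gen k)) * exp_sum k w"])
  note e = hom_mult[OF exp_sum_hom, simplified]
  show "(\<lambda>w. exp_sum i (s w)) \<in> hom (free_group n) integer_group"
    using s by (intro homI) (auto simp: hom_mult hom_in_carrier e[of _ n])
  show "(\<lambda>w. \<Sum>k<n. exp_sum i (s (free_gen k)) * exp_sum k w) \<in> hom (free_group n) integer_group"
    by (intro homI) (auto simp: e[of _ n] distrib_left sum.distrib)
  fix j assume j: "j < n"
  then show "exp_sum i (s (free_gen j)) = (\<Sum>k<n. exp_sum i (s (free_gen k)) * exp_sum k (free_gen j))"
    by (simp add: exp_sum_free_gen if_distrib[of "\<lambda>c. _ * c"] cong: if_cong)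
qed

text \<open>The explicit form of \<open>ab_matrix\<close>, available also for iterates that are only
  known to be homomorphisms.\<close>

definition exp_mat :: "nat \<Rightarrow> (letter list \<Rightarrow> letter list) \<Rightarrow> int mat" where
  "exp_mat n s = mat n n (\<lambda>(i, j). exp_sum i (s (free_gen j)))"

lemma exp_mat_carrier [simp]: "exp_mat n s \<in> carrier_mat n n"
  by (simp add: exp_mat_def)

lemma exp_mat_comp:
  assumes s: "s \<in> hom (free_group n) (free_group n)"
    and t: "\<And>j. j < n \<Longrightarrow> t (free_gen j) \<in> carrier (free_group n)"
  shows "exp_mat n (\<lambda>x. s (t x)) = exp_mat n s * exp_mat n t"
  using t by (intro eq_matI)
    (auto simp: exp_mat_def scalar_prod_def exp_sum_hom_image[OF s] lessThan_atLeast0)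

lemma exp_mat_id: "(\<And>j. j < n \<Longrightarrow> s (free_gen j) = free_gen j) \<Longrightarrow> exp_mat n s = 1\<^sub>m n"
  by (intro eq_matI) (auto simp: exp_mat_def exp_sum_free_gen)

lemma exp_mat_funpow:
  assumes s: "s \<in> hom (free_group n) (free_group n)"
  shows "exp_mat n (s ^^ k) = exp_mat n s ^\<^sub>m k"
proof (induction k)
  case 0
  have "dim_row (exp_mat n s) = n" by (simp add: exp_mat_def)
  then show ?case by (simp add: exp_mat_id)
next
  case (Suc k)
  have "exp_mat n (\<lambda>x. (s ^^ k) (s x)) = exp_mat n (s ^^ k) * exp_mat n s"
    using s by (intro exp_mat_comp hom_funpow) (auto simp: hom_in_carrier free_gen_closed)
  then show ?case by (simp add: Suc funpow_Suc_right o_def del: funpow.simps)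
qed

text \<open>On integer combinations of exponent sums, \<open>diff_along s\<close> acts on the row of
  coefficients by right multiplication with \<open>exp_mat n s - 1\<^sub>m n\<close>.\<close>

lemma diff_along_exp_sum_funpow:
  assumes s: "s \<in> hom (free_group n) (free_group n)" and i: "i < n"
  shows "w \<in> carrier (free_group n) \<Longrightarrow> (diff_along s ^^ k) (exp_sum i) w
    = (\<Sum>j<n. ((exp_mat n s - 1\<^sub>m n) ^\<^sub>m k) $$ (i, j) * exp_sum j w)"
proof (induction k arbitrary: w)
  case 0
  then show ?case using i by (simp add: exp_mat_def if_distrib[of "\<lambda>c. c * _"] cong: if_cong)
next
  case (Suc k)
  let ?N = "exp_mat n s - 1\<^sub>m n"
  let ?B = "?N ^\<^sub>m k"
  have N: "?N \<in> carrier_mat n n" by (simp add: minus_carrier_mat)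
  have B: "?B \<in> carrier_mat n n" using N by (rule pow_carrier_mat)
  have e: "exp_sum j (s w) - exp_sum j w = (\<Sum>l<n. ?N $$ (j, l) * exp_sum l w)" if "j < n" for j
  proof -
    have "(\<Sum>l<n. ?N $$ (j, l) * exp_sum l w)
        = (\<Sum>l<n. exp_sum j (s (free_gen l)) * exp_sum l w - (if j = l then exp_sum l w else 0))"
      using that by (intro sum.cong) (auto simp: exp_mat_def left_diff_distrib)
    then show ?thesis
      using that by (simp add: exp_sum_hom_image[OF s Suc.prems] sum_subtractf)
  qed
  have "(diff_along s ^^ Suc k) (exp_sum i) w
      = (\<Sum>j<n. ?B $$ (i, j) * (exp_sum j (s w) - exp_sum j w))"
    using Suc.IH[of w] Suc.IH[of "s w"] Suc.prems s
    by (simp add: diff_along_def[of s "(diff_along s ^^ k) (exp_sum i)"] hom_in_carrier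
        sum_subtractf right_diff_distrib)
  also have "\<dots> = (\<Sum>j<n. \<Sum>l<n. ?B $$ (i, j) * ?N $$ (j, l) * exp_sum l w)"
    by (simp add: e sum_distrib_left mult.assoc)
  also have "\<dots> = (\<Sum>l<n. (\<Sum>j<n. ?B $$ (i, j) * ?N $$ (j, l)) * exp_sum l w)"
    by (subst sum.swap) (simp add: sum_distrib_right)
  also have "\<dots> = (\<Sum>l<n. (?N ^\<^sub>m Suc k) $$ (i, l) * exp_sum l w)"
  proof (intro sum.cong refl)
    fix l assume "l \<in> {..<n}"
    then have "(?B * ?N) $$ (i, l) = (\<Sum>j<n. ?B $$ (i, j) * ?N $$ (j, l))"
      using i N B by (simp add: scalar_prod_def lessThan_atLeast0 del: minus_mat_def)
    then show "(\<Sum>j<n. ?B $$ (i, j) * ?N $$ (j, l)) * exp_sum l w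
        = (?N ^\<^sub>m Suc k) $$ (i, l) * exp_sum l w" by simp
  qed
  finally show ?case .
qed

text \<open>As \<open>n \<le> p ^ m\<close>, the \<open>p ^ m\<close>-fold difference kills the
  exponent sums, and by \<open>diff_along_prime_power\<close> it is congruent to the difference
  along \<open>s ^^ (p ^ m)\<close>.\<close>

lemma exp_sum_unipotent:
  fixes p :: nat
  assumes s: "s \<in> hom (free_group n) (free_group n)" and p: "prime p" and n: "n \<le> p ^ m"
    and nil: "(exp_mat n s - 1\<^sub>m n) ^\<^sub>m n = 0\<^sub>m n n"
    and i: "i < n" and w: "w \<in> carrier (free_group n)"
  shows "[exp_sum i ((s ^^ (p ^ m)) w) = exp_sum i w] (mod int p)"
proof -
  let ?N = "exp_mat n s - 1\<^sub>m n"
  have z: "?N ^\<^sub>m k = 0\<^sub>m n n" if "n \<le> k" for k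
    using that
  proof (induction k rule: dec_induct)
    case (step k)
    then show ?case by (simp add: left_mult_zero_mat[of _ n])
  qed (rule nil)
  have "(diff_along s ^^ (p ^ m)) (exp_sum i) w = 0"
    using diff_along_exp_sum_funpow[OF s i w, of "p ^ m"] i by (simp add: z[OF n])
  then show ?thesis
    using diff_along_prime_power[OF p refl, where f = "exp_sum i" and \<sigma> = s and x = w and m = m] by simp
qed

section \<open>Eigenvalues that are roots of unity\<close>

text \<open>For \<open>j \<le> i\<close> only the summand \<open>k = i\<close> of the matrix product
  can survive: smaller \<open>k\<close> vanish by induction, larger ones by triangularity.\<close>

lemma upper_triangular_pow:
  fixes T :: "'a::comm_ring_1 mat"
  assumes T: "T \<in> carrier_mat n n" and ut: "upper_triangular T"
  shows "i < n \<Longrightarrow> j < n \<Longrightarrow> j \<le> i \<Longrightarrow> (T ^\<^sub>m r) $$ (i, j) = (if i = j then T $$ (i, i) ^ r else 0)"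
proof (induction r arbitrary: i j)
  case 0
  then show ?case using T by simp
next
  case (Suc r)
  have Tr: "T ^\<^sub>m r \<in> carrier_mat n n" using T by (rule pow_carrier_mat)
  have "(T ^\<^sub>m Suc r) $$ (i, j) = (\<Sum>k\<in>{0..<n}. (T ^\<^sub>m r) $$ (i, k) * T $$ (k, j))"
    using Suc.prems T Tr by (simp add: scalar_prod_def)
  also have "\<dots> = (\<Sum>k\<in>{0..<n}. if k = i then (if i = j then T $$ (i, i) ^ Suc r else 0) else 0)"
  proof (intro sum.cong refl)
    fix k assume k: "k \<in> {0..<n}"
    consider "k < i" | "k = i" | "i < k" by linarith
    then show "(T ^\<^sub>m r) $$ (i, k) * T $$ (k, j)
        = (if k = i then (if i = j then T $$ (i, i) ^ Suc r else 0) else 0)"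
    proof cases
      case 1
      then show ?thesis using Suc.IH[of i k] Suc.prems k by simp
    next
      case 2
      then show ?thesis
        using Suc.IH[of i i] Suc.prems T upper_triangularD[OF ut, of j i] by (auto simp: mult.commute)
    next
      case 3
      then show ?thesis using upper_triangularD[OF ut, of j k] Suc.prems T k by auto
    qed
  qed
  finally show ?case using Suc.prems by simp
qed

lemma strictly_upper_triangular_nilpotent:
  fixes S :: "'a::comm_ring_1 mat"
  assumes S: "S \<in> carrier_mat n n" and z: "\<And>i j. i < n \<Longrightarrow> j < n \<Longrightarrow> j \<le> i \<Longrightarrow> S $$ (i, j) = 0"
  shows "S ^\<^sub>m n = 0\<^sub>m n n"
proof -
  \<comment> \<open>Each further factor clears one more superdiagonal; for \<open>k = n\<close>
    nothing is left.\<close>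
  have *: "i < n \<Longrightarrow> j < n \<Longrightarrow> j < i + k \<Longrightarrow> (S ^\<^sub>m k) $$ (i, j) = 0" for i j k
  proof (induction k arbitrary: i j)
    case 0
    then show ?case using S by simp
  next
    case (Suc k)
    have Sk: "S ^\<^sub>m k \<in> carrier_mat n n" using S by (rule pow_carrier_mat)
    have "(S ^\<^sub>m Suc k) $$ (i, j) = (\<Sum>l\<in>{0..<n}. (S ^\<^sub>m k) $$ (i, l) * S $$ (l, j))"
      using Suc.prems S Sk by (simp add: scalar_prod_def)
    also have "\<dots> = 0"
    proof (intro sum.neutral ballI)
      fix l assume "l \<in> {0..<n}"
      then show "(S ^\<^sub>m k) $$ (i, l) * S $$ (l, j) = 0"
        using Suc.IH[of i l] Suc.prems z[of l j] by (cases "l < i + k") auto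
    qed
    finally show ?case .
  qed
  have "S ^\<^sub>m n \<in> carrier_mat n n" using S by (rule pow_carrier_mat)
  then show ?thesis using * by (intro eq_matI) auto
qed

text \<open>Schur decomposition makes \<open>A\<close> similar to an upper triangular
  \<open>T\<close> with the eigenvalues on its diagonal. Then
  \<open>T ^\<^sub>m r - 1\<^sub>m n\<close> is strictly upper triangular, and nilpotency passes
  back through the similarity.\<close>

lemma pow_minus_one_nilpotent:
  fixes A :: "complex mat"
  assumes A: "A \<in> carrier_mat n n" and ev: "\<And>z. eigenvalue A z \<Longrightarrow> z ^ r = 1"
  shows "(A ^\<^sub>m r - 1\<^sub>m n) ^\<^sub>m n = 0\<^sub>m n n"
proof -
  obtain as where cp: "char_poly A = (\<Prod>a\<leftarrow>as. [:- a, 1:])"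
    using char_poly_factorized[OF A] by blast
  obtain T P Q where dec: "schur_decomposition A as = (T, P, Q)" by (metis prod_cases3)
  have wit: "similar_mat_wit A T P Q" and ut: "upper_triangular T" and diag: "diag_mat T = as"
    using schur_decomposition[OF A cp dec] by auto
  have T: "T \<in> carrier_mat n n" and P: "P \<in> carrier_mat n n" and Q: "Q \<in> carrier_mat n n"
    and PQ: "P * Q = 1\<^sub>m n" "Q * P = 1\<^sub>m n"
    using similar_mat_witD2[OF A wit] by auto
  have "T $$ (i, i) ^ r = 1" if "i < n" for i
  proof (rule ev)
    have "T $$ (i, i) \<in> set as" using that T by (auto simp: diag[symmetric] diag_mat_def)
    then show "eigenvalue A (T $$ (i, i))"
      unfolding eigenvalue_root_char_poly[OF A] cp by (simp add: poly_prod_list prod_list_zero_iff)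
  qed
  then have nil: "(T ^\<^sub>m r - 1\<^sub>m n) ^\<^sub>m n = 0\<^sub>m n n"
    using T upper_triangular_pow[OF T ut]
    by (intro strictly_upper_triangular_nilpotent) (auto simp: minus_carrier_mat)
  have Tr: "T ^\<^sub>m r \<in> carrier_mat n n" and Ar: "A ^\<^sub>m r \<in> carrier_mat n n"
    using T A by (auto intro: pow_carrier_mat)
  have "A ^\<^sub>m r - 1\<^sub>m n = P * T ^\<^sub>m r * Q - P * 1\<^sub>m n * Q"
    using similar_mat_wit_pow_id[OF wit, of r] P PQ by simp
  also have "\<dots> = P * (T ^\<^sub>m r - 1\<^sub>m n) * Q"
    using P Q Tr by (simp add: minus_mult_distrib_mat[of _ n n] mult_minus_distrib_mat[of _ n n])
  finally have "similar_mat_wit (A ^\<^sub>m r - 1\<^sub>m n) (T ^\<^sub>m r - 1\<^sub>m n) P Q"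
    using P Q Tr Ar PQ by (intro similar_mat_witI[of _ _ n]) (auto simp: minus_carrier_mat)
  from similar_mat_wit_pow_id[OF this, of n] nil P Q show ?thesis
    by (simp add: right_mult_zero_mat[of _ n n] left_mult_zero_mat[of _ n n])
qed

lemma int_pow_minus_one_nilpotent:
  fixes M :: "int mat"
  assumes M: "M \<in> carrier_mat n n" and ev: "\<And>z. eigenvalue (map_mat complex_of_int M) z \<Longrightarrow> z ^ r = 1"
  shows "(M ^\<^sub>m r - 1\<^sub>m n) ^\<^sub>m n = 0\<^sub>m n n"
proof -
  let ?h = "map_mat complex_of_int"
  have Mr: "M ^\<^sub>m r \<in> carrier_mat n n" using M by (rule pow_carrier_mat)
  have N: "M ^\<^sub>m r - 1\<^sub>m n \<in> carrier_mat n n" by (simp add: minus_carrier_mat)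
  have "?h ((M ^\<^sub>m r - 1\<^sub>m n) ^\<^sub>m n) = (?h (M ^\<^sub>m r - 1\<^sub>m n)) ^\<^sub>m n"
    by (rule of_int_hom.mat_hom_pow[OF N])
  also have "?h (M ^\<^sub>m r - 1\<^sub>m n) = ?h M ^\<^sub>m r - 1\<^sub>m n"
    unfolding of_int_hom.mat_hom_pow[OF M, symmetric]
    using carrier_matD[OF Mr] by (intro eq_matI) auto
  also have "\<dots> ^\<^sub>m n = 0\<^sub>m n n"
    using M ev by (intro pow_minus_one_nilpotent) auto
  finally have *: "?h ((M ^\<^sub>m r - 1\<^sub>m n) ^\<^sub>m n) = 0\<^sub>m n n" .
  have c: "(M ^\<^sub>m r - 1\<^sub>m n) ^\<^sub>m n \<in> carrier_mat n n" using N by (rule pow_carrier_mat)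
  show ?thesis
  proof (intro eq_matI)
    fix i j assume "i < dim_row (0\<^sub>m n n)" "j < dim_col (0\<^sub>m n n)"
    then show "((M ^\<^sub>m r - 1\<^sub>m n) ^\<^sub>m n) $$ (i, j) = 0\<^sub>m n n $$ (i, j)"
      using arg_cong[OF *, of "\<lambda>X. X $$ (i, j)"] c by simp
  qed (use c in auto)
qed

text \<open>An integer root of the characteristic polynomial divides its constant term, which is the
  determinant up to sign and hence a unit.\<close>

lemma int_eigenvalue_unit:
  fixes M N :: "int mat"
  assumes M: "M \<in> carrier_mat n n" and N: "N \<in> carrier_mat n n" and MN: "M * N = 1\<^sub>m n"
    and ev: "eigenvalue (map_mat complex_of_int M) z" and z: "z \<in> \<int>"
  shows "z = 1 \<or> z = - 1"
proof -
  obtain k where k: "z = of_int k" using z by (auto elim: Ints_cases)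
  have "poly (char_poly (map_mat complex_of_int M)) z = 0"
    using ev M by (subst (asm) eigenvalue_root_char_poly[of _ n]) auto
  then have "poly (map_poly complex_of_int (char_poly M)) (of_int k) = 0"
    by (simp add: of_int_hom.char_poly_hom[OF M] k)
  then have root: "poly (char_poly M) k = 0" by simp
  have "k dvd poly (char_poly M) 0"
  proof (cases "char_poly M")
    case (pCons a q)
    then show ?thesis using root by (simp add: eq_neg_iff_add_eq_0[symmetric])
  qed
  moreover have "poly (char_poly M) 0 dvd 1"
  proof -
    have "poly (char_poly M) 0 = det ((- 1) \<cdot>\<^sub>m M)"
      unfolding char_poly_def using M
      by (intro poly_det_cong[of _ n]) (auto simp: char_poly_matrix_def)
    also have "\<dots> = (- 1) ^ n * det M" using M by simp
    finally have "poly (char_poly M) 0 = (- 1) ^ n * det M" .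
    moreover have "det M dvd 1" using det_mult[OF M N] MN by (metis det_one dvd_triv_left)
    ultimately show ?thesis by (simp add: abs_mult power_abs)
  qed
  ultimately have "k dvd 1" by (rule dvd_trans)
  then have "k = 1 \<or> k = - 1" by auto
  then show ?thesis by (auto simp: k)
qed

section \<open>From eigenvalues to residual properties\<close>

text \<open>The matrix of \<open>\<phi> ^^ (p ^ a)\<close> is unipotent; iterating this map
  \<open>p ^ n\<close> times makes it trivial on the homology modulo \<open>p\<close>, as
  \<open>n \<le> p ^ n\<close>. The total exponent is \<open>p ^ (a + n)\<close>.\<close>

lemma free_by_cyclic_targets_eigenvalues:
  fixes p :: nat
  assumes \<phi>: "\<phi> \<in> auto (free_group n)" and p: "prime p"
    and ev: "\<And>z. eigenvalue (map_mat complex_of_int (ab_matrix n \<phi>)) z \<Longrightarrow> z ^ (p ^ a) = 1"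
    and g: "g \<in> carrier (semidirect_int (free_group n) \<phi>)" "g \<noteq> \<one>\<^bsub>semidirect_int (free_group n) \<phi>\<^esub>"
  shows "\<exists>(K :: (letter list \<times> int) set monoid) h. nilpotent_group K \<and> finite_p_group p K \<and>
    h \<in> hom (semidirect_int (free_group n) \<phi>) K \<and> h g \<noteq> \<one>\<^bsub>K\<^esub>"
proof -
  have s: "\<phi> \<in> hom (free_group n) (free_group n)" using \<phi> by (simp add: auto_def)
  have M: "ab_matrix n \<phi> = exp_mat n \<phi>" by (simp add: ab_matrix_eq[OF \<phi>] exp_mat_def)
  have nil: "(exp_mat n (\<phi> ^^ (p ^ a)) - 1\<^sub>m n) ^\<^sub>m n = 0\<^sub>m n n"
    unfolding exp_mat_funpow[OF s] using ev by (intro int_pow_minus_one_nilpotent) (simp_all add: M)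
  have n: "n \<le> p ^ n" using prime_gt_1_nat[OF p] by (simp add: less_imp_le)
  have "[exp_sum i ((\<phi> ^^ (p ^ (a + n))) (free_gen j)) = exp_sum i (free_gen j)] (mod int p)"
    if "i < n" "j < n" for i j
    using exp_sum_unipotent[OF hom_funpow[OF s] p n nil that(1) free_gen_closed[OF that(2)]]
    by (simp add: funpow_mult power_add)
  from free_by_cyclic_targets[OF \<phi> p this g] show ?thesis by simp
qed

theorem theorem6p5:
  fixes n :: nat and \<phi> :: "letter list \<Rightarrow> letter list"
  defines "G \<equiv> semidirect_int (free_group n) \<phi>"
    and "A \<equiv> map_mat complex_of_int (ab_matrix n \<phi>)"
  assumes "\<phi> \<in> auto (free_group n)"
    and "\<forall>z. eigenvalue A z \<longrightarrow> z \<in> \<int>"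
  shows "residually_nilpotent G
    \<and> ((\<forall>z. eigenvalue A z \<longrightarrow> z = 1) \<longrightarrow> (\<forall>p::nat. prime p \<longrightarrow> residually_p_finite p G))
    \<and> (eigenvalue A (- 1) \<longrightarrow> residually_p_finite 2 G)"
proof -
  note \<phi> = assms(3) and F = group_free_group
  \<comment> \<open>The inverse automorphism supplies an integral inverse of the matrix, so integer
    eigenvalues are \<open>1\<close> or \<open>- 1\<close>.\<close>
  let ?\<psi> = "\<phi> [^]\<^bsub>AutoGroup (free_group n)\<^esub> (- 1 :: int)"
  have s: "\<phi> \<in> hom (free_group n) (free_group n)" using \<phi> by (simp add: auto_def)
  have \<psi>: "?\<psi> \<in> auto (free_group n)" by (rule int_pow_auto_closed[OF F \<phi>])
  have "\<phi> (?\<psi> x) = x" if "x \<in> carrier (free_group n)" for x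
    using int_pow_auto_add[OF F \<phi> that, of 1 "- 1"] int_pow_auto_0[OF F \<phi> that]
    by (simp only: int_pow_auto_1[OF F \<phi>] add.right_inverse)
  then have "exp_mat n \<phi> * exp_mat n ?\<psi> = 1\<^sub>m n"
    using exp_mat_comp[OF s, of ?\<psi>] auto_closed[OF \<psi>]
    by (simp add: free_gen_closed exp_mat_id)
  moreover have "ab_matrix n \<phi> = exp_mat n \<phi>" by (simp add: ab_matrix_eq[OF \<phi>] exp_mat_def)
  ultimately have unit: "z = 1 \<or> z = - 1" if "eigenvalue A z" for z
    using int_eigenvalue_unit[of "exp_mat n \<phi>" n "exp_mat n ?\<psi>" z] assms(4) that
    by (simp add: A_def)
  \<comment> \<open>Both possible eigenvalues are square roots of \<open>1\<close>, so the exponent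
    \<open>2 ^ 1\<close> works; the same target is nilpotent and a finite 2-group.\<close>
  have two: "\<exists>(K :: (letter list \<times> int) set monoid) h. nilpotent_group K \<and> finite_p_group 2 K \<and>
      h \<in> hom G K \<and> h g \<noteq> \<one>\<^bsub>K\<^esub>" if "g \<in> carrier G" "g \<noteq> \<one>\<^bsub>G\<^esub>" for g
  proof (unfold G_def, rule free_by_cyclic_targets_eigenvalues[OF \<phi>, where a = 1])
    fix z assume "eigenvalue (map_mat complex_of_int (ab_matrix n \<phi>)) z"
    then show "z ^ (2 ^ 1) = 1" using unit[of z] by (auto simp: A_def)
  qed (use that in \<open>simp_all add: G_def\<close>)
  \<comment> \<open>With all eigenvalues \<open>1\<close> the exponent is \<open>p ^ 0\<close>,
    which leaves the prime arbitrary.\<close>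
  have one: "\<exists>(K :: (letter list \<times> int) set monoid) h. nilpotent_group K \<and> finite_p_group p K \<and>
      h \<in> hom G K \<and> h g \<noteq> \<one>\<^bsub>K\<^esub>"
    if "\<forall>z. eigenvalue A z \<longrightarrow> z = 1" "prime p" "g \<in> carrier G" "g \<noteq> \<one>\<^bsub>G\<^esub>" for g p
  proof (unfold G_def, rule free_by_cyclic_targets_eigenvalues[OF \<phi>, where a = 0])
    fix z assume "eigenvalue (map_mat complex_of_int (ab_matrix n \<phi>)) z"
    then show "z ^ (p ^ 0) = 1" using that(1) by (simp add: A_def)
  qed (use that in \<open>simp_all add: G_def\<close>)
  show ?thesis
    unfolding residually_nilpotent_def residually_p_finite_def
  proof (intro conjI impI allI ballI)
    fix g assume "g \<in> carrier G" "g \<noteq> \<one>\<^bsub>G\<^esub>"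
    from two[OF this] show "\<exists>(K :: (letter list \<times> int) set monoid) h. nilpotent_group K \<and> h \<in> hom G K \<and> h g \<noteq> \<one>\<^bsub>K\<^esub>"
      by (elim exE conjE) (intro exI conjI)
  next
    fix p g assume "\<forall>z. eigenvalue A z \<longrightarrow> z = 1" "prime (p::nat)" "g \<in> carrier G" "g \<noteq> \<one>\<^bsub>G\<^esub>"
    from one[OF this] show "\<exists>(K :: (letter list \<times> int) set monoid) h. finite_p_group p K \<and> h \<in> hom G K \<and> h g \<noteq> \<one>\<^bsub>K\<^esub>"
      by (elim exE conjE) (intro exI conjI)
  next
    fix g assume "g \<in> carrier G" "g \<noteq> \<one>\<^bsub>G\<^esub>"
    from two[OF this] show "\<exists>(K :: (letter list \<times> int) set monoid) h. finite_p_group 2 K \<and> h \<in> hom G K \<and> h g \<noteq> \<one>\<^bsub>K\<^esub>"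
      by (elim exE conjE) (intro exI conjI)
  qed
qed

end
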